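(* Let $f\in L_p(\mathbb{R}^d)$, $0<p\le \infty$, $\alpha\in \mathbb{N}\cup ((1/p-1)_+,\infty)$, $\lambda>0$, and $\delta>0$. Then $$\omega_\alpha(f,\lambda \delta)_p\lesssim (1+\lambda)^{\alpha+d(\frac1p-1)_+}\,\omega_\alpha(f,\delta)_p .$$ Equivalently, for any $0<h<\delta$, $$\frac{\omega_\alpha(f,\delta)_p}{\delta^{\alpha+d(\frac1p-1)_+}}\lesssim \frac{\omega_\alpha(f,h)_p}{h^{\alpha+d(\frac1p-1)_+}}.$$
   Context: Here $d\ge 1$, $\|\cdot\|_p$ is the (quasi-)norm of $L_p(\mathbb{R}^d)$, $a_+=\max\{a,0\}$, and $1/\infty=0$. For $\alpha>0$ and $h\in\mathbb{R}^d$ the (fractional) difference is $\Delta_h^\alpha f(x)=\sum_{\nu=0}^\infty(-1)^\nu\binom{\alpha}{\nu}f(x+(\alpha-\nu)h)$, where $\binom{\alpha}{\nu}=\frac{\alpha(\alpha-1)\cdots(\alpha-\nu+1)}{\nu!}$, $\binom{\alpha}{0}=1$ (for $\alpha\in\mathbb{N}$ this is the usual $\alpha$-th difference), and the modulus of smoothness is $\omega_\alpha(f,\delta)_p=\sup_{|h|\le\delta}\|\Delta_h^\alpha f\|_p$, with $|h|$ the Euclidean norm. $F\lesssim G$ means $F\le CG$ with a constant $C>0$ depending only on $p,\alpha,d$ (not on $f,\delta,\lambda,h$). *)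

theory Defs
  imports "HOL-Analysis.Analysis" "HOL-Probability.Essential_Supremum"
begin

(* Meant for a > 0 only: then 0 is sent to 0 and infinity to infinity. *)
definition ennreal_powr :: "ennreal \<Rightarrow> real \<Rightarrow> ennreal" where
  "ennreal_powr x a = (if x = \<infinity> then \<infinity> else ennreal (enn2real x powr a))"

definition Lp_norm :: "ennreal \<Rightarrow> ('a::euclidean_space \<Rightarrow> complex) \<Rightarrow> ennreal" where
  "Lp_norm p f =
     (if p = \<infinity> then esssup lebesgue (\<lambda>x. ennreal (norm (f x)))
      else ennreal_powr (\<integral>\<^sup>+ x. ennreal (norm (f x) powr enn2real p) \<partial>lebesgue) (1 / enn2real p))"

definition Lp_space :: "ennreal \<Rightarrow> ('a::euclidean_space \<Rightarrow> complex) set" where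
  "Lp_space p = {f \<in> borel_measurable lebesgue. Lp_norm p f < \<infinity>}"

(* The series is taken pointwise.  For f in L_p and alpha admissible it converges
   absolutely for almost every x; on the remaining null set the value of the
   infinite sum is irrelevant. *)
definition frac_diff ::
  "real \<Rightarrow> 'a::euclidean_space \<Rightarrow> ('a \<Rightarrow> complex) \<Rightarrow> 'a \<Rightarrow> complex" where
  "frac_diff \<alpha> h f x =
     (\<Sum>\<nu>. ((- 1) ^ \<nu> * (\<alpha> gchoose \<nu>)) *\<^sub>R f (x + (\<alpha> - real \<nu>) *\<^sub>R h))"

definition modulus_smoothness ::
  "real \<Rightarrow> ennreal \<Rightarrow> ('a::euclidean_space \<Rightarrow> complex) \<Rightarrow> real \<Rightarrow> ennreal" where
  "modulus_smoothness \<alpha> p f \<delta> = (SUP h\<in>{h. norm h \<le> \<delta>}. Lp_norm p (frac_diff \<alpha> h f))"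

(* (1/p - 1)_+ ; division on ennreal gives 1 / infinity = 0 *)
definition p_excess :: "ennreal \<Rightarrow> real" where
  "p_excess p = max (enn2real (1 / p) - 1) 0"

end

theory Submission
  imports Defs "HOL-Computational_Algebra.Formal_Laurent_Series"
begin

text \<open>
  Everything happens along one line. A vector of length at most \<lambda> \<delta> is nh with
  n = \<lceil>\<lambda>\<rceil> and norm h \<le> \<delta>. Writing a difference as a power of 1 - T with T the
  translation by -h, the factorization
    (1 - T^n)^\<alpha> = ((1 - T^n)/(1 - T))^\<alpha> (1 - T)^\<alpha>
  expresses the difference with step nh as a series of translates of the difference with step h,
  with the coefficients c_k of ((1-z^n)/(1-z))^\<alpha> (lemma \<open>frac_diff_dilate\<close>).
  With q = min(1,p), such a series of translates has (quasi-)norm at most (\<Sum> |c_k|^q)^(1/q)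
  times that of the function (\<open>Lp_shift_sum\<close>). So the theorem follows from
    \<Sum>_k |c_k|^q \<le> K n^((\<alpha>-1)q+1)
  (\<open>quot_pow_powr_sum\<close>), whose q-th root is of order n^(\<alpha> + 1/q - 1), where
  1/q - 1 = (1/p-1)_+ \<le> d (1/p-1)_+.

  For the coefficient estimate, indices are written k = jn + m with m < n. Heuristically c_k is of
  size n^(\<alpha>-1) in block j = 0 and decays like (j+1)^(-(\<alpha>+1)) from block to block; the
  condition \<alpha> > 1/q - 1 makes the q-th powers summable, while for natural \<alpha> only
  finitely many blocks occur. The decay comes from cancellation, which a direct estimate of the product
  (1-z^n)^\<alpha> (1-z)^(-\<alpha>) loses. It is recovered from the derivative: with
  R = \<Sum>_(l<n) l z^l,
    z d/dz ((1 - z^n)/(1 - z))^(\<alpha>+1) = (\<alpha>+1) R ((1 - z^n)/(1 - z))^\<alpha>,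
  so that k c_k is a short weighted sum of coefficients for the smaller exponent. This yields an
  induction from \<alpha> to \<alpha> + 1 (\<open>block_decay_Suc\<close>). It starts at \<alpha> = 1,
  where the coefficients are explicit, or at 0 < \<alpha> < 1 (\<open>quot_pow_nth_small\<close>), where
  the same derivative, with R (1 - z) kept together, can be estimated by absolute values.
\<close>

section \<open>Powers of 1 - X^n and their quotients\<close>

text \<open>
  The series (1 - X^n)^a. Its coefficients for n = 1 are those of the difference of order a
  with step h, and for general n those of the difference with step nh, read as a series in
  translations by -h.
\<close>
definition one_minus_pow :: "nat \<Rightarrow> real \<Rightarrow> real fps" where
  "one_minus_pow n a = fps_binomial a oo (- (fps_X ^ n))"

text \<open>
  The series ((1 - X^n) / (1 - X))^a: for natural a the power (1 + X + ... + X^(n-1))^a.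
\<close>
definition quot_pow :: "nat \<Rightarrow> real \<Rightarrow> real fps" where
  "quot_pow n a = one_minus_pow n a * one_minus_pow 1 (- a)"

lemma one_minus_pow_nth:
  assumes "n \<ge> 1"
  shows "fps_nth (one_minus_pow n a) k =
           (if n dvd k then (- 1) ^ (k div n) * (a gchoose (k div n)) else 0)"
proof -
  have z: "fps_nth (fps_X ^ n :: real fps) 0 = 0"
    using assms by simp
  have "- (fps_X ^ n) = (- fps_X :: real fps) oo (fps_X ^ n)"
    using z by (simp add: fps_compose_uminus)
  then have "one_minus_pow n a = (fps_binomial a oo (- fps_X)) oo (fps_X ^ n)"
    unfolding one_minus_pow_def using z by (subst fps_compose_assoc[symmetric]) auto
  then show ?thesis
    using assms by (simp add: fps_nth_compose_X_power fps_compose_uminus')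
qed

lemma one_minus_pow_add:
  assumes "n \<ge> 1"
  shows "one_minus_pow n (a + b) = one_minus_pow n a * one_minus_pow n b"
  unfolding one_minus_pow_def fps_binomial_add_mult
  using assms by (intro fps_compose_mult_distrib) auto

lemma one_minus_pow_0 [simp]: "one_minus_pow n 0 = 1"
  by (simp add: one_minus_pow_def)

lemma one_minus_pow_1:
  assumes "n \<ge> 1"
  shows "one_minus_pow n 1 = 1 - fps_X ^ n"
  using assms by (simp add: one_minus_pow_def fps_binomial_1 fps_compose_add_distrib)

text \<open>
  Multiplying the derivative by X keeps the powers X^n intact, and on coefficients it is
  multiplication by the index; this is the form in which derivatives are used below.
\<close>
lemma one_minus_pow_deriv:
  assumes "n \<ge> 1"
  shows "fps_X * fps_deriv (one_minus_pow n a)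
           = - (fps_const a * of_nat n * fps_X ^ n * one_minus_pow n (a - 1))"
proof -
  have b: "fps_deriv (fps_binomial a) = fps_const a * fps_binomial (a - 1)"
  proof -
    have u: "fps_nth (1 + fps_X :: real fps) 0 \<noteq> 0" by simp
    have "fps_binomial a = (1 + fps_X) * fps_binomial (a - 1)"
      using fps_binomial_add_mult[of 1 "a - 1"] by (simp add: fps_binomial_1)
    then show ?thesis
      unfolding fps_binomial_deriv
      by (simp add: fps_divide_def mult.assoc inverse_mult_eq_1'[OF u] mult.left_commute)
  qed
  have "fps_deriv (one_minus_pow n a)
      = (fps_const a * one_minus_pow n (a - 1)) * fps_deriv (- (fps_X ^ n))"
  proof -
    have z: "fps_nth (- (fps_X ^ n) :: real fps) 0 = 0"
      using assms by simp
    show ?thesis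
      unfolding one_minus_pow_def fps_compose_deriv[OF z] b fps_compose_mult_distrib[OF z] by simp
  qed
  moreover have "fps_X * fps_deriv (- (fps_X ^ n)) = - (of_nat n * (fps_X :: real fps) ^ n)"
  proof -
    obtain m where m: "n = Suc m"
      using assms by (cases n) auto
    show ?thesis
      unfolding m fps_deriv_neg fps_deriv_power' by (simp only: fps_deriv_fps_X diff_Suc_1 power_Suc) (simp only: mult_ac mult_1_left mult_1_right mult_minus_right)
  qed
  ultimately have "fps_X * fps_deriv (one_minus_pow n a)
      = (fps_const a * one_minus_pow n (a - 1)) * - (of_nat n * fps_X ^ n)"
    by (simp only: mult.left_commute[of fps_X "fps_const a * one_minus_pow n (a - 1)"])
  then show ?thesis
    by (simp only: mult_minus_right mult_ac)
qed

lemma quot_pow_mult: "quot_pow n a * one_minus_pow 1 a = one_minus_pow n a"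
  using one_minus_pow_add[of 1 "- a" a] by (simp add: quot_pow_def mult.assoc)

lemma quot_pow_1_nth:
  assumes "n \<ge> 1"
  shows "fps_nth (quot_pow n 1) k = (if k < n then 1 else 0)"
proof -
  have "one_minus_pow n 1 = (\<Sum>k<n. fps_X ^ k) * one_minus_pow 1 1"
    using assms by (simp add: one_minus_pow_1 one_diff_power_eq mult.commute)
  then have "quot_pow n 1 = (\<Sum>k<n. fps_X ^ k)"
    using one_minus_pow_add[of 1 1 "- 1"] by (simp add: quot_pow_def mult.assoc)
  then show ?thesis
    by (simp add: fps_sum_nth)
qed

text \<open>
  The polynomial R for which a quotient power Q of exponent a satisfies
  X Q' (1 - X^n) = a R (1 - X) Q.
\<close>
definition ramp :: "nat \<Rightarrow> real fps" where
  "ramp n = (\<Sum>l<n. of_nat l * fps_X ^ l)"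

text \<open>
  The product telescopes: a factor 1 - X turns the ramp into n - 1 differences
  X^i - X^n, whose cancellation makes the coefficients in \<open>ramp_block_bound\<close> decay.
\<close>
lemma ramp_mult:
  assumes "n \<ge> 1"
  shows "ramp n * (1 - fps_X) = (\<Sum>i=1..<n. fps_X ^ i - fps_X ^ n)"
proof -
  have "ramp (Suc n) * (1 - fps_X) = (\<Sum>i=1..<Suc n. fps_X ^ i) - of_nat n * fps_X ^ Suc n" for n
  proof (induction n)
    case (Suc n)
    have "ramp (Suc (Suc n)) * (1 - fps_X)
        = ramp (Suc n) * (1 - fps_X) + of_nat (Suc n) * fps_X ^ Suc n * (1 - fps_X)"
      by (simp only: ramp_def sum.lessThan_Suc distrib_right)
    also have "\<dots> = (\<Sum>i=1..<Suc n. fps_X ^ i) + fps_X ^ Suc n - of_nat (Suc n) * fps_X ^ Suc (Suc n)"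
      unfolding Suc.IH by (simp add: algebra_simps)
    finally show ?case
      by simp
  qed (simp add: ramp_def)
  from this[of "n - 1"] show ?thesis
    using assms by (simp add: sum_subtractf of_nat_diff)
qed

lemma ramp_mult_square:
  "ramp n * (1 - fps_X) * (1 - fps_X) = fps_X * (1 - fps_X ^ n) - of_nat n * fps_X ^ n * (1 - fps_X)"
  by (induction n) (simp_all add: ramp_def algebra_simps)

text \<open>
  The product rule puts the two logarithmic derivatives X/(1-X) and n X^n/(1-X^n) over a
  common denominator, and \<open>ramp_mult_square\<close> identifies the numerator.
\<close>
lemma quot_pow_deriv:
  assumes "n \<ge> 1"
  shows "fps_X * fps_deriv (quot_pow n a)
           = fps_const a * (one_minus_pow n (a - 1) * (one_minus_pow 1 (- a) * (ramp n * (1 - fps_X))))"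
proof -
  let ?P = one_minus_pow
  have e1: "?P n a = (1 - fps_X ^ n) * ?P n (a - 1)"
    using one_minus_pow_add[OF assms, of 1 "a - 1"] by (simp only: one_minus_pow_1[OF assms]) simp
  have e2: "?P 1 (- a) = (1 - fps_X) * ?P 1 (- a - 1)"
    using one_minus_pow_add[of 1 1 "- a - 1"] by (simp add: one_minus_pow_1)
  have "fps_X * fps_deriv (quot_pow n a)
     = ?P n a * (fps_X * fps_deriv (?P 1 (- a))) + (fps_X * fps_deriv (?P n a)) * ?P 1 (- a)"
    by (simp add: quot_pow_def algebra_simps)
  also have "\<dots> = fps_const a * ?P n (a - 1) * ?P 1 (- a - 1)
       * (fps_X * (1 - fps_X ^ n) - of_nat n * fps_X ^ n * (1 - fps_X))"
  proof -
    have d: "fps_X * fps_deriv (?P 1 (- a)) = fps_const a * fps_X * ?P 1 (- a - 1)"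
      using one_minus_pow_deriv[OF order_refl, of "- a"] by (simp flip: fps_const_neg)
    have key: "(1 - N) * u * (A * x * v) + - (A * m * N * u) * ((1 - x) * v)
        = A * u * v * (x * (1 - N) - m * N * (1 - x))" for A N u v x m :: "real fps"
      by (simp add: algebra_simps)
    show ?thesis
      by (simp only: one_minus_pow_deriv[OF assms] d, simp only: e1 e2, rule key)
  qed
  also have "\<dots> = fps_const a * ?P n (a - 1) * ((1 - fps_X) * ?P 1 (- a - 1)) * (ramp n * (1 - fps_X))"
    unfolding ramp_mult_square[symmetric] by (simp only: mult_ac)
  finally show ?thesis
    unfolding e2[symmetric] by (simp only: mult_ac)
qed

text \<open>
  The factor 1 - X next to the ramp makes the exponents of 1 - X^n and 1 - X opposite again,
  so that differentiation leads from a quotient power to the one of exponent lower by one. This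
  drives the induction on the exponent.
\<close>
lemma quot_pow_deriv_Suc:
  assumes "n \<ge> 1"
  shows "fps_X * fps_deriv (quot_pow n (a + 1)) = fps_const (a + 1) * (ramp n * quot_pow n a)"
proof -
  have "one_minus_pow 1 (- (a + 1)) * (1 - fps_X) = one_minus_pow 1 (- a)"
    using one_minus_pow_add[of 1 "- (a + 1)" 1] by (simp add: one_minus_pow_1)
  then show ?thesis
    unfolding quot_pow_deriv[OF assms] by (simp add: quot_pow_def mult_ac)
qed

lemma fps_X_deriv_nth: "fps_nth (fps_X * fps_deriv f) k = of_nat k * fps_nth f k"
  by (simp add: fps_mult_fps_X_deriv_shift)

lemma quot_pow_nth_0: "n \<ge> 1 \<Longrightarrow> fps_nth (quot_pow n a) 0 = 1"
  by (simp add: quot_pow_def one_minus_pow_nth)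

lemma quot_pow_Suc_nth:
  assumes "n \<ge> 1"
  shows "real k * fps_nth (quot_pow n (a + 1)) k
           = (a + 1) * (\<Sum>i\<le>k. (if k - i < n then real (k - i) * fps_nth (quot_pow n a) i else 0))"
proof -
  have r: "fps_nth (ramp n) l = (if l < n then real l else 0)" for l
  proof -
    have "fps_nth (of_nat i * fps_X ^ i) l = (if l = i then real l else 0)" for i
      by (simp only: fps_of_nat[symmetric] fps_mult_left_const_nth fps_X_power_nth) auto
    then show ?thesis
      unfolding ramp_def fps_sum_nth by (simp add: sum.delta)
  qed
  have "real k * fps_nth (quot_pow n (a + 1)) k = (a + 1) * fps_nth (quot_pow n a * ramp n) k"
    using arg_cong[OF quot_pow_deriv_Suc[OF assms, of a], of "\<lambda>f. fps_nth f k"]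
    unfolding fps_X_deriv_nth fps_mult_left_const_nth mult.commute[of "ramp n"] .
  then show ?thesis
    by (auto simp: fps_mult_nth r atLeast0AtMost intro!: sum.cong)
qed

section \<open>Power estimates and binomial coefficients\<close>

text \<open>
  Bernoulli's inequality for exponents in [0,1]: convexity of the exponential between 0 and
  ln (1 + x).
\<close>
lemma bernoulli_powr:
  fixes x \<sigma> :: real
  assumes "-1 \<le> x" "0 \<le> \<sigma>" "\<sigma> \<le> 1"
  shows "(1 + x) powr \<sigma> \<le> 1 + \<sigma> * x"
proof (cases "x = -1")
  case False
  with assms have pos: "0 < 1 + x" by simp
  have "exp ((1 - \<sigma>) *\<^sub>R 0 + \<sigma> *\<^sub>R ln (1 + x)) \<le> (1 - \<sigma>) * exp 0 + \<sigma> * exp (ln (1 + x))"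
    using assms by (intro convex_onD[OF exp_convex]) auto
  with pos show ?thesis
    by (simp add: powr_def algebra_simps)
qed (use assms in auto)

lemma sum_powr_le:
  fixes s :: real
  assumes "0 < s" "s \<le> 1"
  shows "(\<Sum>t<n. (real t + 1) powr (s - 1)) \<le> real n powr s / s"
proof (induction n)
  case (Suc n)
  let ?y = "real n + 1"
  have "(1 + (- (1 / ?y))) powr s \<le> 1 + s * (- (1 / ?y))"
    using assms by (intro bernoulli_powr) (auto simp: field_simps)
  moreover have "1 + (- (1 / ?y)) = real n / ?y"
    by (simp add: field_simps)
  ultimately have "(real n / ?y) powr s \<le> 1 - s / ?y"
    by simp
  then have "?y powr s * (real n / ?y) powr s \<le> ?y powr s * (1 - s / ?y)"
    by (intro mult_left_mono) auto
  then have "real n powr s \<le> ?y powr s - s * ?y powr (s - 1)"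
    by (simp add: powr_divide powr_diff field_simps)
  then have "?y powr (s - 1) \<le> ?y powr s / s - real n powr s / s"
    using assms by (simp add: field_simps)
  with Suc show ?case
    by (simp add: add.commute)
qed simp

lemma summable_shift_powr:
  assumes "a > 1"
  shows "summable (\<lambda>i. (real i + 1) powr (- a))"
proof -
  have "summable (\<lambda>i. real (Suc i) powr (- a))"
    using assms by (subst summable_Suc_iff) (simp add: summable_real_powr_iff)
  then show ?thesis by (simp add: add.commute)
qed

text \<open>
  A convolution of two power sequences decays like the slower one as soon as the other is
  summable. Of the two indices u = i+1 and v = j-i+1 the larger is at least (j+1)/2; if it is
  v, then v^(-b) gives the decay and u^(-a) is left to be summed, and if it is u, then
  u^(-b) gives the decay and u^(b-a) v^(-b) \<le> v^(-a) is left.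
\<close>
lemma convolution_powr_le:
  fixes a b :: real
  assumes "a > 1" "0 \<le> b" "b \<le> a"
  shows "\<exists>K\<ge>0. \<forall>j. (\<Sum>i\<le>j. (real i + 1) powr (- a) * (real (j - i) + 1) powr (- b))
                    \<le> K * (real j + 1) powr (- b)"
proof -
  define S where "S = (\<Sum>i. (real i + 1) powr (- a))"
  have S: "(\<Sum>i\<le>j. (real i + 1) powr (- a)) \<le> S" for j
    unfolding S_def using summable_shift_powr[OF assms(1)] by (intro sum_le_suminf) auto
  have pw: "(real j + 1) powr b * (u powr (- a) * v powr (- b)) \<le> 2 powr b * (u powr (- a) + v powr (- a))"
    if "u > 0" "v > 0" "u + v \<ge> real j + 1" for u v :: real and j
  proof (cases "u \<le> v")
    case True
    have "(real j + 1) powr b \<le> (2 * v) powr b"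
      using that True assms by (intro powr_mono2) auto
    then have "(real j + 1) powr b * (u powr (- a) * v powr (- b))
        \<le> (2 powr b * v powr b) * (u powr (- a) * v powr (- b))"
      using that by (intro mult_right_mono) (auto simp: powr_mult)
    also have "\<dots> = 2 powr b * u powr (- a)"
      using that by (simp add: powr_minus field_simps)
    finally show ?thesis
      by (smt (verit) mult_left_mono powr_ge_zero)
  next
    case False
    have "(real j + 1) powr b \<le> (2 * u) powr b"
      using that False assms by (intro powr_mono2) auto
    then have "(real j + 1) powr b * (u powr (- a) * v powr (- b))
        \<le> (2 powr b * u powr b) * (u powr (- a) * v powr (- b))"
      using that by (intro mult_right_mono) (auto simp: powr_mult)
    also have "\<dots> = 2 powr b * (u powr (b - a) * v powr (- b))"
      using that by (simp add: powr_minus powr_diff field_simps)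
    also have "\<dots> \<le> 2 powr b * (v powr (b - a) * v powr (- b))"
      using that False assms by (intro mult_left_mono mult_right_mono powr_mono2') auto
    also have "\<dots> = 2 powr b * v powr (- a)"
      using that by (simp flip: powr_add)
    finally show ?thesis
      by (smt (verit) mult_left_mono powr_ge_zero)
  qed
  show ?thesis
  proof (intro exI[of _ "2 powr b * (2 * S)"] conjI allI)
    show "0 \<le> 2 powr b * (2 * S)"
      using S[of 0] by simp
    fix j
    have "(real j + 1) powr b * (\<Sum>i\<le>j. (real i + 1) powr (- a) * (real (j - i) + 1) powr (- b))
        \<le> (\<Sum>i\<le>j. 2 powr b * ((real i + 1) powr (- a) + (real (j - i) + 1) powr (- a)))"
      unfolding sum_distrib_left by (intro sum_mono pw) auto
    also have "\<dots> = 2 powr b * ((\<Sum>i\<le>j. (real i + 1) powr (- a)) + (\<Sum>i\<le>j. (real (j - i) + 1) powr (- a)))"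
      by (simp add: sum_distrib_left sum.distrib distrib_left)
    also have "(\<Sum>i\<le>j. (real (j - i) + 1) powr (- a)) = (\<Sum>i\<le>j. (real i + 1) powr (- a))"
      using sum.atLeastAtMost_rev[of "\<lambda>i. (real i + 1) powr (- a)" 0 j] by (simp add: atLeast0AtMost)
    also have "2 powr b * ((\<Sum>i\<le>j. (real i + 1) powr (- a)) + (\<Sum>i\<le>j. (real i + 1) powr (- a)))
        \<le> 2 powr b * (2 * S)"
      using S[of j] by (intro mult_left_mono) auto
    finally show "(\<Sum>i\<le>j. (real i + 1) powr (- a) * (real (j - i) + 1) powr (- b))
        \<le> 2 powr b * (2 * S) * (real j + 1) powr (- b)"
      by (simp add: powr_minus field_simps)
  qed
qed

lemma binomial_coeff_rec:
  "fps_nth (one_minus_pow 1 (- b)) (Suc k) = fps_nth (one_minus_pow 1 (- b)) k * ((b + real k) / (real k + 1))"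
proof -
  have "(real k + 1) * (- b gchoose Suc k) = (- b - real k) * (- b gchoose k)"
    using gbinomial_mult_1[of "- b" k] by (simp add: algebra_simps)
  then have "(- b gchoose Suc k) = - ((- b gchoose k) * ((b + real k) / (real k + 1)))"
    by (simp add: field_simps)
  then show ?thesis
    by (simp only: one_minus_pow_nth[OF order_refl] one_dvd if_True div_by_1 power_Suc)
qed

text \<open>
  The coefficients of (1-X)^(-b) have ratios 1 - (1-b)/(k+1). By Bernoulli's inequality
  such a ratio is at most ((k+1)/(k+2))^(1-b), the ratio of the powers on the right.
\<close>
lemma binomial_coeff_bounds:
  fixes b :: real
  assumes "0 < b" "b < 1"
  defines "A \<equiv> fps_nth (one_minus_pow 1 (- b))"
  shows "0 \<le> A k" "A k \<le> (real k + 1) powr (b - 1)"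
proof -
  have "0 \<le> A k \<and> A k \<le> (real k + 1) powr (b - 1)"
  proof (induction k)
    case 0
    then show ?case by (simp add: A_def one_minus_pow_nth)
  next
    case (Suc k)
    let ?x = "1 / (real k + 1)"
    have step: "(b + real k) / (real k + 1) = 1 - (1 - b) * ?x"
      by (simp add: field_simps)
    have nn: "0 \<le> (b + real k) / (real k + 1)"
      using assms by simp
    have "(1 + ?x) powr (1 - b) * ((b + real k) / (real k + 1))
        \<le> (1 + (1 - b) * ?x) * ((b + real k) / (real k + 1))"
      using assms nn by (intro mult_right_mono bernoulli_powr order_trans[of "-1" 0 ?x]) auto
    also have "\<dots> = 1 - ((1 - b) * ?x)\<^sup>2"
      unfolding step by (simp add: power2_eq_square algebra_simps)
    also have "\<dots> \<le> 1" by simp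
    finally have "(b + real k) / (real k + 1) \<le> 1 / (1 + ?x) powr (1 - b)"
      by (simp add: field_simps)
    also have "1 + ?x = (real k + 2) / (real k + 1)"
      by (simp add: field_simps)
    also have "1 / ((real k + 2) / (real k + 1)) powr (1 - b) = (real k + 1) powr (1 - b) / (real k + 2) powr (1 - b)"
      by (simp add: powr_divide)
    finally have "(real k + 1) powr (b - 1) * ((b + real k) / (real k + 1))
        \<le> (real k + 1) powr (b - 1) * ((real k + 1) powr (1 - b) / (real k + 2) powr (1 - b))"
      by (intro mult_left_mono) auto
    also have "\<dots> = (real k + 2) powr (b - 1)"
    proof -
      have "(real k + 1) powr (b - 1) * (real k + 1) powr (1 - b) = 1"
        by (simp flip: powr_add)
      then show ?thesis
        using powr_minus_divide[of "real k + 2" "1 - b"] by simp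
    qed
    finally have "(real k + 1) powr (b - 1) * ((b + real k) / (real k + 1)) \<le> (real k + 2) powr (b - 1)" .
    moreover have "A (Suc k) \<le> (real k + 1) powr (b - 1) * ((b + real k) / (real k + 1))"
      unfolding A_def binomial_coeff_rec using Suc nn by (intro mult_right_mono) (auto simp: A_def)
    moreover have "0 \<le> A (Suc k)"
      unfolding A_def binomial_coeff_rec using Suc nn by (intro mult_nonneg_nonneg) (auto simp: A_def)
    ultimately show ?case by (simp add: add.commute)
  qed
  then show "0 \<le> A k" "A k \<le> (real k + 1) powr (b - 1)" by auto
qed

lemma binomial_coeff_diff:
  fixes b :: real
  assumes "0 < b" "b < 1"
  defines "A \<equiv> fps_nth (one_minus_pow 1 (- b))"
  shows "0 \<le> A t - A (t + l)" "A t - A (t + l) \<le> real l * (real t + 1) powr (b - 2)"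
proof -
  have one: "0 \<le> A t - A (Suc t) \<and> A t - A (Suc t) \<le> (real t + 1) powr (b - 2)" for t
  proof -
    have "A t - A (Suc t) = A t * ((1 - b) / (real t + 1))"
      unfolding A_def binomial_coeff_rec by (simp add: field_simps)
    moreover have "0 \<le> A t * ((1 - b) / (real t + 1))"
      using assms binomial_coeff_bounds(1)[OF assms(1,2), of t] by (simp add: A_def)
    moreover have "A t * ((1 - b) / (real t + 1)) \<le> (real t + 1) powr (b - 1) * (1 / (real t + 1))"
      using assms binomial_coeff_bounds[OF assms(1,2), of t]
      by (intro mult_mono) (auto simp: A_def divide_simps)
    moreover have "(real t + 1) powr (b - 1) * (1 / (real t + 1)) = (real t + 1) powr (b - 2)"
      using powr_diff[of "real t + 1" "b - 1" 1] by simp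
    ultimately show ?thesis by simp
  qed
  have "0 \<le> A t - A (t + l) \<and> A t - A (t + l) \<le> real l * (real t + 1) powr (b - 2)"
  proof (induction l)
    case (Suc l)
    have "(real (t + l) + 1) powr (b - 2) \<le> (real t + 1) powr (b - 2)"
      using assms by (intro powr_mono2') auto
    with Suc one[of "t + l"] show ?case
      by (simp add: algebra_simps)
  qed simp
  then show "0 \<le> A t - A (t + l)" "A t - A (t + l) \<le> real l * (real t + 1) powr (b - 2)" by auto
qed

section \<open>Quotient coefficients for exponents below one\<close>

text \<open>
  Convolving with a series in X^n acts separately on the residue classes modulo n.
  Writing an index as jn + m with m < n turns it into a convolution in the block number j.
\<close>
lemma sum_multiples:
  fixes g h :: "nat \<Rightarrow> real"
  assumes "m < n"
  shows "(\<Sum>l=0..j*n+m. (if n dvd l then g (l div n) else 0) * h (j*n+m-l))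
           = (\<Sum>i\<le>j. g i * h ((j-i)*n+m))"
proof -
  have "(\<Sum>l=0..j*n+m. (if n dvd l then g (l div n) else 0) * h (j*n+m-l))
      = (\<Sum>l\<in>(\<lambda>i. i * n) ` {..j}. (if n dvd l then g (l div n) else 0) * h (j*n+m-l))"
  proof (rule sum.mono_neutral_right)
    show "(\<lambda>i. i * n) ` {..j} \<subseteq> {0..j*n+m}"
      by (auto intro!: trans_le_add1 mult_le_mono1)
    show "\<forall>l\<in>{0..j*n+m} - (\<lambda>i. i * n) ` {..j}.
        (if n dvd l then g (l div n) else 0) * h (j*n+m-l) = 0"
    proof
      fix l assume l: "l \<in> {0..j*n+m} - (\<lambda>i. i * n) ` {..j}"
      have "\<not> n dvd l"
      proof
        assume "n dvd l"
        then obtain i where i: "l = i * n" by (metis dvd_def mult.commute)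
        have "i * n < (j + 1) * n"
          using l i assms by simp
        then have "i \<le> j"
          using mult_less_cancel2[of i n "j + 1"] by linarith
        with l i show False by auto
      qed
      then show "(if n dvd l then g (l div n) else 0) * h (j*n+m-l) = 0" by simp
    qed
  qed simp
  also have "\<dots> = (\<Sum>i\<le>j. g i * h (j*n+m-i*n))"
    using assms by (subst sum.reindex) (auto simp: inj_on_def)
  also have "\<dots> = (\<Sum>i\<le>j. g i * h ((j-i)*n+m))"
  proof (rule sum.cong)
    fix i assume "i \<in> {..j}"
    then have "j*n+m-i*n = (j-i)*n+m"
      by (simp add: diff_mult_distrib mult_le_mono1)
    then show "g i * h (j*n+m-i*n) = g i * h ((j-i)*n+m)" by simp
  qed simp
  finally show ?thesis .
qed

lemma quot_pow_nth_less:
  assumes "m < n"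
  shows "fps_nth (quot_pow n a) m = fps_nth (one_minus_pow 1 (- a)) m"
proof -
  have n: "n \<ge> 1" using assms by simp
  have "fps_nth (quot_pow n a) (0 * n + m) = (\<Sum>i\<le>0. (- 1) ^ i * (a gchoose i) * fps_nth (one_minus_pow 1 (- a)) ((0-i)*n+m))"
    unfolding quot_pow_def fps_mult_nth one_minus_pow_nth[OF n]
    by (rule sum_multiples[OF assms])
  then show ?thesis by simp
qed

text \<open>
  The coefficient of index M = in + m is a sum of fewer than n differences
  A_(M-t) - A_(M-n), where A is the decreasing sequence of coefficients of (1-X)^(-b).
  In block 0 only the terms A_(M-t) occur, and they add up to at most n^b/b. In block 1
  the bound A_m for each term reflects the singularity of A at the start of the block.
  In later blocks the increments of A gain the factor (i+1)^(b-2).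
\<close>
lemma ramp_block_bound:
  fixes b :: real
  assumes "0 < b" "b < 1"
  defines "D \<equiv> \<lambda>n. one_minus_pow 1 (- b) * (ramp n * (1 - fps_X))"
  assumes "m < n"
  shows "\<bar>fps_nth (D n) (i*n+m)\<bar>
           \<le> (1 / b + 9) * (real n * (real m + 1) powr (b - 1)) * (real i + 1) powr (b - 2)"
proof -
  define A where "A = fps_nth (one_minus_pow 1 (- b))"
  note A0 = binomial_coeff_bounds(1)[OF assms(1,2), folded A_def]
  note A1 = binomial_coeff_bounds(2)[OF assms(1,2), folded A_def]
  note Ad = binomial_coeff_diff[OF assms(1,2), folded A_def]
  have n: "n \<ge> 1" using assms by simp
  define \<phi> where "\<phi> = (real m + 1) powr (b - 1)"
  have \<phi>: "\<phi> \<ge> 0" "real n powr (b - 1) \<le> \<phi>"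
    unfolding \<phi>_def using assms by (auto intro!: powr_mono2')
  have nb: "real n powr b \<le> real n * \<phi>"
  proof -
    have "real n powr b = real n * real n powr (b - 1)"
      using n by (simp add: powr_diff)
    with \<phi> show ?thesis
      by (simp add: mult_left_mono)
  qed
  have nth: "fps_nth (D n) M = (\<Sum>t=1..<n. (if t \<le> M then A (M - t) else 0) - (if n \<le> M then A (M - n) else 0))" for M
  proof -
    have "fps_nth (D n) M
        = (\<Sum>t=1..<n. fps_nth (one_minus_pow 1 (- b) * fps_X ^ t) M - fps_nth (one_minus_pow 1 (- b) * fps_X ^ n) M)"
      unfolding D_def ramp_mult[OF n]
      by (simp only: sum_distrib_left fps_sum_nth right_diff_distrib fps_sub_nth)
    then show ?thesis
      by (auto simp: fps_X_power_mult_right_nth A_def intro!: sum.cong)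
  qed
  consider "i = 0" | "i = 1" | "i \<ge> 2" by linarith
  then have "\<bar>fps_nth (D n) (i*n+m)\<bar> \<le> (1 / b + 9) * (real n * \<phi>) * (real i + 1) powr (b - 2)"
  proof cases
    case 1
    have "fps_nth (D n) m = (\<Sum>t=1..<n. if t \<le> m then A (m - t) else 0)"
      using assms(4) by (simp add: nth)
    also have "\<dots> = (\<Sum>t=1..m. A (m - t))"
      using assms by (intro sum.mono_neutral_cong_right) auto
    also have "\<dots> = (\<Sum>t<m. A t)"
      by (rule sum.reindex_bij_witness[of _ "\<lambda>t. m - t" "\<lambda>t. m - t"]) auto
    finally have e: "fps_nth (D n) m = (\<Sum>t<m. A t)" .
    have "(\<Sum>t<m. A t) \<le> (\<Sum>t<n. A t)"
      using assms A0 by (intro sum_mono2) auto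
    also have "\<dots> \<le> (\<Sum>t<n. (real t + 1) powr (b - 1))"
      by (intro sum_mono A1)
    also have "\<dots> \<le> real n powr b / b"
      using assms by (intro sum_powr_le) auto
    also have "\<dots> \<le> real n * \<phi> / b"
      using nb assms by (simp add: divide_right_mono)
    also have "\<dots> \<le> (1 / b + 9) * (real n * \<phi>)"
      using \<phi> by (simp add: algebra_simps)
    finally have "(\<Sum>t<m. A t) \<le> (1 / b + 9) * (real n * \<phi>)" .
    moreover have "(\<Sum>t<m. A t) \<ge> 0"
      using A0 by (intro sum_nonneg)
    ultimately show ?thesis
      using 1 e by simp
  next
    case 2
    have "fps_nth (D n) (n + m) = (\<Sum>t=1..<n. A (n + m - t) - A m)"
      using assms(4) by (simp add: nth)
    also have "\<bar>\<dots>\<bar> \<le> (\<Sum>t=1..<n. \<phi>)"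
    proof (rule order_trans[OF sum_abs sum_mono])
      fix t assume t: "t \<in> {1..<n}"
      have "A (n + m - t) \<le> A m"
        using Ad(1)[of m "n - t"] t by (simp add: add.commute)
      moreover have "A m \<le> \<phi>"
        unfolding \<phi>_def by (rule A1)
      ultimately show "\<bar>A (n + m - t) - A m\<bar> \<le> \<phi>"
        using A0[of "n + m - t"] by linarith
    qed
    also have "\<dots> \<le> real n * \<phi>"
      using \<phi> by (simp add: mult_right_mono)
    also have "\<dots> \<le> 9 * (real n * \<phi>) * (1 / 4)"
      using \<phi> by simp
    also have "\<dots> \<le> (1 / b + 9) * (real n * \<phi>) * (1 + 1) powr (b - 2)"
    proof (rule mult_mono)
      have "(2::real) powr (-2) \<le> 2 powr (b - 2)"
        using assms by (intro powr_mono) auto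
      then show "1 / 4 \<le> (1 + 1 :: real) powr (b - 2)"
        by (simp add: powr_minus)
      show "9 * (real n * \<phi>) \<le> (1 / b + 9) * (real n * \<phi>)"
        using \<phi> assms by (intro mult_right_mono) auto
    qed (use \<phi> assms in auto)
    finally show ?thesis
      using 2 by simp
  next
    case 3
    define M where "M = i*n+m"
    have Mn: "real M - real n + 1 \<ge> real n * ((real i + 1) / 3)"
    proof -
      have "real n * ((real i + 1) / 3) \<le> real n * (real i - 1)"
        using 3 by (intro mult_left_mono) auto
      then show ?thesis by (simp add: M_def algebra_simps)
    qed
    have nM: "2 * n \<le> M"
      using 3 unfolding M_def by (simp add: trans_le_add1)
    have "fps_nth (D n) M = (\<Sum>t=1..<n. A (M - t) - A (M - n))"
      using nM by (auto simp: nth intro!: sum.cong)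
    also have "\<bar>\<dots>\<bar> \<le> (\<Sum>t=1..<n. 9 * (real n powr (b - 1) * (real i + 1) powr (b - 2)))"
    proof (rule order_trans[OF sum_abs sum_mono])
      fix t assume t: "t \<in> {1..<n}"
      have e: "M - n + (n - t) = M - t"
        using t nM by simp
      have "\<bar>A (M - t) - A (M - n)\<bar> = A (M - n) - A (M - t)"
        using Ad(1)[of "M - n" "n - t"] by (simp only: e)
      also have "\<dots> \<le> real (n - t) * (real (M - n) + 1) powr (b - 2)"
        using Ad(2)[of "M - n" "n - t"] by (simp only: e)
      also have "\<dots> \<le> real n * (real n * ((real i + 1) / 3)) powr (b - 2)"
        using n nM Mn assms by (intro mult_mono powr_mono2') (auto simp: of_nat_diff)
      also have "\<dots> = real n powr (b - 1) * (real i + 1) powr (b - 2) * 3 powr (2 - b)"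
      proof -
        have "real n * real n powr (b - 2) = real n powr (b - 1)"
          using n powr_add[of "real n" 1 "b - 2"] by simp
        moreover have "(1 / 3 :: real) powr (b - 2) = 3 powr (2 - b)"
          using powr_minus_divide[of "3::real" "b - 2"] by (simp add: powr_divide)
        moreover have "real n * (real n * ((real i + 1) / 3)) powr (b - 2)
            = (real n * real n powr (b - 2)) * ((real i + 1) powr (b - 2) * (1 / 3) powr (b - 2))"
          using powr_mult[of "real i + 1" "1/3" "b - 2"] powr_mult[of "real n" "(real i + 1) / 3" "b - 2"]
          by simp
        ultimately show ?thesis
          by (simp only: mult_ac)
      qed
      also have "\<dots> \<le> real n powr (b - 1) * (real i + 1) powr (b - 2) * 9"
      proof (rule mult_left_mono)
        have "(3::real) powr (2 - b) \<le> 3 powr 2"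
          using assms by (intro powr_mono) auto
        then show "(3::real) powr (2 - b) \<le> 9" by simp
      qed simp
      finally show "\<bar>A (M - t) - A (M - n)\<bar> \<le> 9 * (real n powr (b - 1) * (real i + 1) powr (b - 2))"
        by (simp add: mult_ac)
    qed
    also have "\<dots> \<le> real n * (9 * (real n powr (b - 1) * (real i + 1) powr (b - 2)))"
      by (simp add: mult_right_mono)
    also have "\<dots> = 9 * real n powr b * (real i + 1) powr (b - 2)"
      using n powr_add[of "real n" 1 "b - 1"] by simp
    also have "\<dots> \<le> (1 / b + 9) * (real n * \<phi>) * (real i + 1) powr (b - 2)"
      using nb \<phi> assms by (intro mult_right_mono mult_mono) auto
    finally show ?thesis
      by (simp add: M_def)
  qed
  then show ?thesis
    by (simp add: \<phi>_def)
qed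

text \<open>
  Block j carries a singularity (m+1)^(b-1) at its start, damped by (j+1)^(-(b+1)).
  Estimating the product defining the quotient power term by term in absolute value
  would only give the decay (j+1)^(b-1), because it ignores the cancellation between the blocks.
  In its derivative the cancellation is already inside the ramp factor, so the
  convolution can be estimated by absolute values; it decays like (j+1)^(-b), and dividing by the index jn + m gives one more power.
\<close>
lemma quot_pow_nth_small:
  fixes b :: real
  assumes b: "0 < b" "b < 1"
  shows "\<exists>K\<ge>0. \<forall>n j m. m < n \<longrightarrow> \<bar>fps_nth (quot_pow n b) (j*n+m)\<bar>
           \<le> K * (real m + 1) powr (b - 1) * (real j + 1) powr (- (b + 1))"
proof -
  obtain Kc where Kc: "Kc \<ge> 0" "\<And>j. (\<Sum>i\<le>j. (real i + 1) powr (- (2 - b)) * (real (j - i) + 1) powr (- b))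
                    \<le> Kc * (real j + 1) powr (- b)"
    using convolution_powr_le[of "2 - b" b] b by auto
  define L where "L = 1 / b + 9"
  have L: "L \<ge> 0" using b by (simp add: L_def)
  define K where "K = 1 + 2 * b * (L * Kc)"
  show ?thesis
  proof (intro exI[of _ K] conjI allI impI)
    show "K \<ge> 0" using b L Kc by (simp add: K_def)
    fix n j m :: nat
    assume mn: "m < n"
    then have n: "n \<ge> 1" by simp
    define \<phi> where "\<phi> = (real m + 1) powr (b - 1)"
    have \<phi>: "\<phi> \<ge> 0" by (simp add: \<phi>_def)
    let ?c = "fps_nth (quot_pow n b)"
    show "\<bar>?c (j*n+m)\<bar> \<le> K * (real m + 1) powr (b - 1) * (real j + 1) powr (- (b + 1))"
    proof (cases "j = 0")
      case True
      have "\<bar>?c m\<bar> \<le> 1 * \<phi>"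
        unfolding quot_pow_nth_less[OF mn] \<phi>_def using binomial_coeff_bounds[OF b, of m] by simp
      also have "\<dots> \<le> K * \<phi>"
        using b L Kc \<phi> by (intro mult_right_mono) (simp_all add: K_def)
      finally show ?thesis
        using True by (simp add: \<phi>_def)
    next
      case False
      define D where "D = one_minus_pow 1 (- b) * (ramp n * (1 - fps_X))"
      define G where "G = (\<lambda>i. (- 1) ^ i * (b - 1 gchoose i))"
      have G: "\<bar>G i\<bar> \<le> (real i + 1) powr (- b)" for i
        using binomial_coeff_bounds[of "1 - b" i] b by (simp add: one_minus_pow_nth G_def)
      have "real (j*n+m) * ?c (j*n+m) = b * fps_nth (one_minus_pow n (b - 1) * D) (j*n+m)"
        using arg_cong[OF quot_pow_deriv[OF n, of b], of "\<lambda>f. fps_nth f (j*n+m)"]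
        unfolding fps_X_deriv_nth fps_mult_left_const_nth D_def[symmetric] .
      also have "fps_nth (one_minus_pow n (b - 1) * D) (j*n+m)
          = (\<Sum>i\<le>j. G i * fps_nth D ((j-i)*n+m))"
        unfolding fps_mult_nth one_minus_pow_nth[OF n] G_def by (rule sum_multiples[OF mn])
      also have "\<dots> = (\<Sum>i\<le>j. G (j - i) * fps_nth D (i*n+m))"
        by (rule sum.reindex_bij_witness[of _ "\<lambda>i. j - i" "\<lambda>i. j - i"]) auto
      finally have "real (j*n+m) * \<bar>?c (j*n+m)\<bar> = b * \<bar>\<Sum>i\<le>j. G (j - i) * fps_nth D (i*n+m)\<bar>"
        using b by (metis abs_mult abs_of_nat abs_of_pos)
      also have "\<dots> \<le> b * (\<Sum>i\<le>j. L * (real n * \<phi>) * ((real i + 1) powr (- (2 - b)) * (real (j - i) + 1) powr (- b)))"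
      proof (intro mult_left_mono order_trans[OF sum_abs sum_mono])
        fix i assume "i \<in> {..j}"
        have "\<bar>G (j - i) * fps_nth D (i*n+m)\<bar>
            \<le> (real (j - i) + 1) powr (- b) * (L * (real n * \<phi>) * (real i + 1) powr (b - 2))"
          unfolding abs_mult L_def \<phi>_def D_def
          by (intro mult_mono G ramp_block_bound b mn) auto
        then show "\<bar>G (j - i) * fps_nth D (i*n+m)\<bar>
            \<le> L * (real n * \<phi>) * ((real i + 1) powr (- (2 - b)) * (real (j - i) + 1) powr (- b))"
          by (simp add: mult_ac)
      qed (use b in auto)
      also have "\<dots> = b * (L * (real n * \<phi>) * (\<Sum>i\<le>j. (real i + 1) powr (- (2 - b)) * (real (j - i) + 1) powr (- b)))"
        by (simp only: sum_distrib_left)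
      also have "\<dots> \<le> b * (L * (real n * \<phi>) * (Kc * (real j + 1) powr (- b)))"
        using b L \<phi> Kc by (intro mult_left_mono) auto
      finally have up: "real (j*n+m) * \<bar>?c (j*n+m)\<bar> \<le> b * (L * (real n * \<phi>) * (Kc * (real j + 1) powr (- b)))" .
      have "real n * ((real j + 1) / 2) \<le> real n * real j"
        using False by (intro mult_left_mono) auto
      also have "\<dots> \<le> real (j*n+m)" by (simp add: mult.commute)
      finally have "real n * ((real j + 1) / 2) * \<bar>?c (j*n+m)\<bar> \<le> real (j*n+m) * \<bar>?c (j*n+m)\<bar>"
        by (intro mult_right_mono) auto
      with up have "real n * ((real j + 1) / 2) * \<bar>?c (j*n+m)\<bar>
          \<le> real n * (b * (L * \<phi> * (Kc * (real j + 1) powr (- b))))"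
        by (simp add: mult_ac)
      then have "(real j + 1) / 2 * \<bar>?c (j*n+m)\<bar> \<le> b * (L * \<phi> * (Kc * (real j + 1) powr (- b)))"
        using n by (simp add: mult.assoc)
      then have "\<bar>?c (j*n+m)\<bar> \<le> 2 * b * (L * Kc) * \<phi> * ((real j + 1) powr (- b) / (real j + 1))"
        by (simp add: field_simps)
      also have "(real j + 1) powr (- b) / (real j + 1) = (real j + 1) powr (- (b + 1))"
        using powr_diff[of "real j + 1" "- b" 1] by simp
      also have "2 * b * (L * Kc) * \<phi> * (real j + 1) powr (- (b + 1)) \<le> K * \<phi> * (real j + 1) powr (- (b + 1))"
        using \<phi> by (intro mult_right_mono) (auto simp: K_def)
      finally show ?thesis by (simp add: \<phi>_def)
    qed
  qed
qed

section \<open>Summability of the quotient coefficients\<close>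

text \<open>
  Decay of the coefficients from block to block at rate s, measured in every l^q with
  q \<le> 1. The power of n is the one produced by n coefficients of size n^(\<alpha>-1).
  Only block sums are bounded, since for \<alpha> < 1 the coefficients are unbounded relative to
  n^(\<alpha>-1) near the start of a block.
\<close>
definition block_decay :: "real \<Rightarrow> real \<Rightarrow> bool" where
  "block_decay \<alpha> s \<longleftrightarrow> (\<forall>q. 0 < q \<and> q \<le> 1 \<longrightarrow> (\<exists>K. \<forall>n\<ge>1. \<forall>j.
     (\<Sum>m<n. \<bar>fps_nth (quot_pow n \<alpha>) (j*n+m)\<bar> powr q)
       \<le> K * (real j + 1) powr (- (s * q)) * real n powr ((\<alpha> - 1) * q + 1)))"

text \<open>
  All coefficients lie in block 0, so any rate is allowed. Natural exponents inherit this
  freedom, which is why they need no lower bound.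
\<close>
lemma block_decay_1: "block_decay 1 s"
  unfolding block_decay_def
proof (intro allI impI exI[of _ 1])
  fix q :: real and n j :: nat
  assume q: "0 < q \<and> q \<le> 1" and n: "n \<ge> 1"
  show "(\<Sum>m<n. \<bar>fps_nth (quot_pow n 1) (j*n+m)\<bar> powr q)
       \<le> 1 * (real j + 1) powr (- (s * q)) * real n powr ((1 - 1) * q + 1)"
  proof (cases j)
    case 0
    with n show ?thesis by (simp add: quot_pow_1_nth)
  next
    case (Suc i)
    then have "\<not> j * n + m < n" for m by simp
    then show ?thesis using n q by (simp add: quot_pow_1_nth)
  qed
qed

lemma block_decay_less_1:
  assumes b: "0 < b" "b < 1"
  shows "block_decay b (b + 1)"
  unfolding block_decay_def
proof (intro allI impI)
  fix q :: real
  assume q: "0 < q \<and> q \<le> 1"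
  obtain K where K: "K \<ge> 0" "\<And>n j m. m < n \<Longrightarrow> \<bar>fps_nth (quot_pow n b) (j*n+m)\<bar>
           \<le> K * (real m + 1) powr (b - 1) * (real j + 1) powr (- (b + 1))"
    using quot_pow_nth_small[OF b] by blast
  define s where "s = (b - 1) * q + 1"
  have s: "0 < s" "s \<le> 1"
  proof -
    have "(1 - b) * q \<le> (1 - b) * 1" using q b by (intro mult_left_mono) auto
    then show "0 < s" using b by (simp add: s_def algebra_simps)
    show "s \<le> 1" using b q by (simp add: s_def mult_nonpos_nonneg)
  qed
  show "\<exists>C. \<forall>n\<ge>1. \<forall>j. (\<Sum>m<n. \<bar>fps_nth (quot_pow n b) (j*n+m)\<bar> powr q)
       \<le> C * (real j + 1) powr (- ((b + 1) * q)) * real n powr ((b - 1) * q + 1)"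
  proof (intro exI[of _ "K powr q / s"] allI impI)
    fix n j :: nat
    assume n: "n \<ge> 1"
    have "(\<Sum>m<n. \<bar>fps_nth (quot_pow n b) (j*n+m)\<bar> powr q)
        \<le> (\<Sum>m<n. (K * (real m + 1) powr (b - 1) * (real j + 1) powr (- (b + 1))) powr q)"
      using q by (intro sum_mono powr_mono2 K) auto
    also have "\<dots> = (\<Sum>m<n. K powr q * (real j + 1) powr (- ((b + 1) * q)) * (real m + 1) powr (s - 1))"
      using K(1) by (intro sum.cong) (auto simp: powr_mult powr_powr s_def simp del: minus_add_distrib)
    also have "\<dots> = K powr q * (real j + 1) powr (- ((b + 1) * q)) * (\<Sum>m<n. (real m + 1) powr (s - 1))"
      by (simp only: sum_distrib_left)
    also have "\<dots> \<le> K powr q * (real j + 1) powr (- ((b + 1) * q)) * (real n powr s / s)"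
      by (intro mult_left_mono sum_powr_le s) auto
    finally show "(\<Sum>m<n. \<bar>fps_nth (quot_pow n b) (j*n+m)\<bar> powr q)
       \<le> K powr q / s * (real j + 1) powr (- ((b + 1) * q)) * real n powr ((b - 1) * q + 1)"
      by (simp add: s_def mult_ac)
  qed
qed

text \<open>
  By \<open>quot_pow_Suc_nth\<close>, the coefficient of index k times k is a sum over the n
  preceding coefficients for the exponent \<alpha>, with weights below n. These lie in the block
  of k and the one before. For j \<ge> 1, dividing by k \<ge> n (j+1)/2 improves the rate by one, and the
  result is a pointwise bound.
\<close>
lemma quot_pow_nth_Suc_bound:
  assumes "\<alpha> > 0" "s \<ge> 0" "block_decay \<alpha> s"
  shows "\<exists>K\<ge>0. \<forall>n j m. m < n \<longrightarrow> \<bar>fps_nth (quot_pow n (\<alpha> + 1)) (j*n+m)\<bar>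
           \<le> K * (real j + 1) powr (- (s + 1)) * real n powr \<alpha>"
proof -
  obtain K0 where K0: "\<And>n j. n \<ge> 1 \<Longrightarrow> (\<Sum>m<n. \<bar>fps_nth (quot_pow n \<alpha>) (j*n+m)\<bar> powr 1)
       \<le> K0 * (real j + 1) powr (- (s * 1)) * real n powr ((\<alpha> - 1) * 1 + 1)"
    using assms(3) unfolding block_decay_def by (metis less_numeral_extra(1) order_refl)
  define K1 where "K1 = max K0 0"
  have K1: "K1 \<ge> 0" "\<And>n j. n \<ge> 1 \<Longrightarrow> (\<Sum>m<n. \<bar>fps_nth (quot_pow n \<alpha>) (j*n+m)\<bar>)
       \<le> K1 * (real j + 1) powr (- s) * real n powr \<alpha>"
  proof -
    fix n j :: nat assume n: "n \<ge> 1"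
    have "K0 * ((real j + 1) powr (- s) * real n powr \<alpha>) \<le> K1 * ((real j + 1) powr (- s) * real n powr \<alpha>)"
      by (intro mult_right_mono) (auto simp: K1_def)
    with K0[OF n, of j] show "(\<Sum>m<n. \<bar>fps_nth (quot_pow n \<alpha>) (j*n+m)\<bar>)
       \<le> K1 * (real j + 1) powr (- s) * real n powr \<alpha>" by (simp add: mult_ac)
  qed (simp add: K1_def)
  define K where "K = 1 + 2 * (\<alpha> + 1) * K1 * (2 powr s + 1)"
  have K: "K \<ge> 1" using assms K1(1) by (simp add: K_def)
  show ?thesis
  proof (intro exI[of _ K] conjI allI impI)
    show "K \<ge> 0" using K by simp
    fix n j m :: nat
    assume mn: "m < n"
    then have n: "n \<ge> 1" by simp
    let ?c = "fps_nth (quot_pow n \<alpha>)" and ?d = "fps_nth (quot_pow n (\<alpha> + 1))"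
    have rec: "real k * \<bar>?d k\<bar> \<le> (\<alpha> + 1) * (real w * (\<Sum>i\<in>I. \<bar>?c i\<bar>))"
      if "finite I" "\<And>i. i \<le> k \<Longrightarrow> k - i < n \<Longrightarrow> i \<in> I" "\<And>i. i \<le> k \<Longrightarrow> k - i < n \<Longrightarrow> k - i \<le> w" for k w I
    proof -
      have "real k * \<bar>?d k\<bar> = \<bar>real k * ?d k\<bar>" by (simp add: abs_mult)
      also have "\<dots> = (\<alpha> + 1) * \<bar>\<Sum>i\<le>k. (if k - i < n then real (k - i) * ?c i else 0)\<bar>"
        unfolding quot_pow_Suc_nth[OF n] using assms by (simp add: abs_mult)
      also have "\<dots> \<le> (\<alpha> + 1) * (\<Sum>i\<le>k. (if k - i < n then real w * \<bar>?c i\<bar> else 0))"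
        using assms that(3)
        by (intro mult_left_mono order_trans[OF sum_abs sum_mono]) (auto simp: abs_mult that(3) simp del: of_nat_diff intro!: mult_right_mono)
      also have "(\<Sum>i\<le>k. (if k - i < n then real w * \<bar>?c i\<bar> else 0)) = (\<Sum>i\<in>{i. i \<le> k \<and> k - i < n}. real w * \<bar>?c i\<bar>)"
        by (intro sum.mono_neutral_cong_right) auto
      also have "\<dots> \<le> (\<Sum>i\<in>I. real w * \<bar>?c i\<bar>)"
        using that by (intro sum_mono2) auto
      finally show ?thesis
        using assms by (simp add: sum_distrib_left)
    qed
    have block: "(\<Sum>i\<in>{j*n..<j*n+n}. \<bar>?c i\<bar>) \<le> K1 * (real j + 1) powr (- s) * real n powr \<alpha>" for j
    proof -
      have "(\<Sum>i\<in>{j*n..<j*n+n}. \<bar>?c i\<bar>) = (\<Sum>m<n. \<bar>?c (j*n+m)\<bar>)"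
        by (rule sum.reindex_bij_witness[of _ "\<lambda>m. j*n+m" "\<lambda>i. i - j*n"]) auto
      with K1(2)[OF n, of j] show ?thesis by simp
    qed
    show "\<bar>?d (j*n+m)\<bar> \<le> K * (real j + 1) powr (- (s + 1)) * real n powr \<alpha>"
    proof (cases "j = 0")
      case True
      have "\<bar>?d m\<bar> \<le> K * real n powr \<alpha>"
      proof (cases "m = 0")
        case True
        have "1 * 1 \<le> K * real n powr \<alpha>"
          using K n assms by (intro mult_mono ge_one_powr_ge_zero) auto
        with True show ?thesis using quot_pow_nth_0[OF n] by simp
      next
        case False
        have "real m * \<bar>?d m\<bar> \<le> (\<alpha> + 1) * (real m * (\<Sum>i\<in>{0*n..<0*n+n}. \<bar>?c i\<bar>))"
          using mn by (intro rec) auto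
        also have "\<dots> \<le> (\<alpha> + 1) * (real m * (K1 * (real 0 + 1) powr (- s) * real n powr \<alpha>))"
          using assms by (intro mult_left_mono block) auto
        finally have "real m * \<bar>?d m\<bar> \<le> real m * ((\<alpha> + 1) * K1 * real n powr \<alpha>)"
          by (simp add: mult_ac)
        then have "\<bar>?d m\<bar> \<le> (\<alpha> + 1) * K1 * real n powr \<alpha>"
          using False by simp
        also have "\<dots> \<le> K * real n powr \<alpha>"
        proof (rule mult_right_mono)
          have "(\<alpha> + 1) * K1 * 1 \<le> (\<alpha> + 1) * K1 * (2 * (2 powr s + 1))"
            using assms K1(1) by (intro mult_left_mono) (auto intro: order_trans[of _ "2 * (0 + 1)"])
          moreover have "(\<alpha> + 1) * K1 * (2 * (2 powr s + 1)) = K - 1"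
            by (simp add: K_def algebra_simps)
          ultimately show "(\<alpha> + 1) * K1 \<le> K" by linarith
        qed simp
        finally show ?thesis .
      qed
      with True show ?thesis by simp
    next
      case False
      then obtain i where i: "j = Suc i" by (cases j) auto
      define X where "X = \<bar>?d (j*n+m)\<bar>"
      let ?J = "(real j + 1) powr (- s)"
      have two: "(real i + 1) powr (- s) \<le> 2 powr s * ?J"
      proof -
        have "(2 * (real i + 1)) powr (- s) \<le> ?J"
          using assms by (intro powr_mono2') (auto simp: i)
        then have "2 powr s * (2 powr (- s) * (real i + 1) powr (- s)) \<le> 2 powr s * ?J"
          unfolding powr_mult by (intro mult_left_mono) auto
        moreover have "2 powr s * (2 powr (- s) * (real i + 1) powr (- s)) = (real i + 1) powr (- s)"
          by (simp add: powr_minus)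
        ultimately show ?thesis by simp
      qed
      have "real (j*n+m) * X \<le> (\<alpha> + 1) * (real n * (\<Sum>k\<in>{i*n..<i*n+n} \<union> {j*n..<j*n+n}. \<bar>?c k\<bar>))"
        unfolding X_def using mn by (intro rec) (auto simp: i)
      also have "(\<Sum>k\<in>{i*n..<i*n+n} \<union> {j*n..<j*n+n}. \<bar>?c k\<bar>)
          = (\<Sum>k\<in>{i*n..<i*n+n}. \<bar>?c k\<bar>) + (\<Sum>k\<in>{j*n..<j*n+n}. \<bar>?c k\<bar>)"
        by (intro sum.union_disjoint) (auto simp: i)
      also have "\<dots> \<le> K1 * (real i + 1) powr (- s) * real n powr \<alpha> + K1 * ?J * real n powr \<alpha>"
        by (intro add_mono block)
      also have "\<dots> \<le> K1 * (2 powr s * ?J) * real n powr \<alpha> + K1 * ?J * real n powr \<alpha>"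
        using two K1(1) by (intro add_right_mono mult_right_mono mult_left_mono) auto
      also have "\<dots> = K1 * (2 powr s + 1) * ?J * real n powr \<alpha>"
        by (simp add: algebra_simps)
      finally have up: "real (j*n+m) * X \<le> (\<alpha> + 1) * (real n * (K1 * (2 powr s + 1) * ?J * real n powr \<alpha>))"
        using assms by (simp add: mult_left_mono)
      have "real n * ((real j + 1) / 2) \<le> real n * real j"
        using False by (intro mult_left_mono) auto
      also have "\<dots> \<le> real (j*n+m)" by (simp add: mult.commute)
      finally have "real n * ((real j + 1) / 2) * X \<le> real (j*n+m) * X"
        by (intro mult_right_mono) (auto simp: X_def)
      then have "real n * ((real j + 1) / 2) * X \<le> (\<alpha> + 1) * (real n * (K1 * (2 powr s + 1) * ?J * real n powr \<alpha>))"
        using up by (rule order_trans)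
      then have "real n * ((real j + 1) / 2 * X) \<le> real n * ((\<alpha> + 1) * (K1 * (2 powr s + 1) * ?J * real n powr \<alpha>))"
        by (simp only: mult_ac)
      then have "(real j + 1) / 2 * X \<le> (\<alpha> + 1) * (K1 * (2 powr s + 1) * ?J * real n powr \<alpha>)"
        using n by simp
      then have "X \<le> 2 * (\<alpha> + 1) * K1 * (2 powr s + 1) * (?J / (real j + 1)) * real n powr \<alpha>"
        by (simp add: field_simps)
      also have "?J / (real j + 1) = (real j + 1) powr (- (s + 1))"
        using powr_diff[of "real j + 1" "- s" 1] by simp
      also have "2 * (\<alpha> + 1) * K1 * (2 powr s + 1) * (real j + 1) powr (- (s + 1)) * real n powr \<alpha>
          \<le> K * (real j + 1) powr (- (s + 1)) * real n powr \<alpha>"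
        by (intro mult_right_mono) (auto simp: K_def)
      finally show ?thesis by (simp add: X_def)
    qed
  qed
qed

lemma block_decay_Suc:
  assumes "\<alpha> > 0" "s \<ge> 0" "block_decay \<alpha> s"
  shows "block_decay (\<alpha> + 1) (s + 1)"
  unfolding block_decay_def
proof (intro allI impI)
  fix q :: real
  assume q: "0 < q \<and> q \<le> 1"
  obtain K where K: "K \<ge> 0" "\<And>n j m. m < n \<Longrightarrow> \<bar>fps_nth (quot_pow n (\<alpha> + 1)) (j*n+m)\<bar>
           \<le> K * (real j + 1) powr (- (s + 1)) * real n powr \<alpha>"
    using quot_pow_nth_Suc_bound[OF assms] by blast
  show "\<exists>C. \<forall>n\<ge>1. \<forall>j. (\<Sum>m<n. \<bar>fps_nth (quot_pow n (\<alpha> + 1)) (j*n+m)\<bar> powr q)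
       \<le> C * (real j + 1) powr (- ((s + 1) * q)) * real n powr ((\<alpha> + 1 - 1) * q + 1)"
  proof (intro exI[of _ "K powr q"] allI impI)
    fix n j :: nat
    assume n: "n \<ge> 1"
    have "(\<Sum>m<n. \<bar>fps_nth (quot_pow n (\<alpha> + 1)) (j*n+m)\<bar> powr q)
        \<le> (\<Sum>m<n. (K * (real j + 1) powr (- (s + 1)) * real n powr \<alpha>) powr q)"
      using q by (intro sum_mono powr_mono2 K) auto
    also have "\<dots> = real n * (K powr q * (real j + 1) powr (- ((s + 1) * q)) * real n powr (\<alpha> * q))"
      using K(1) by (simp add: powr_mult powr_powr del: minus_add_distrib)
    also have "\<dots> = K powr q * (real j + 1) powr (- ((s + 1) * q)) * real n powr ((\<alpha> + 1 - 1) * q + 1)"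
      using n by (simp add: powr_add)
    finally show "(\<Sum>m<n. \<bar>fps_nth (quot_pow n (\<alpha> + 1)) (j*n+m)\<bar> powr q)
        \<le> K powr q * (real j + 1) powr (- ((s + 1) * q)) * real n powr ((\<alpha> + 1 - 1) * q + 1)" .
  qed
qed

lemma block_decay_shift:
  assumes "\<alpha> > 0" "s \<ge> 0" "block_decay \<alpha> s"
  shows "block_decay (\<alpha> + real r) (s + real r)"
proof (induction r)
  case (Suc r)
  have "block_decay (\<alpha> + real r + 1) (s + real r + 1)"
    using assms Suc by (intro block_decay_Suc) auto
  then show ?case by (simp add: add_ac)
qed (use assms in simp)

text \<open>
  For natural \<alpha> the induction starts at 1 with a rate as large as desired; otherwise it
  starts at the fractional part of \<alpha> and ends with the rate \<alpha> + 1.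
\<close>
lemma block_decay_exists:
  assumes "\<alpha> > 0" "0 < q" "\<alpha> \<in> \<nat> \<or> (\<alpha> + 1) * q > 1"
  shows "\<exists>s. s * q > 1 \<and> block_decay \<alpha> s"
proof (cases "\<alpha> \<in> \<nat>")
  case True
  then obtain r where r: "\<alpha> = real r" by (auto simp: Nats_def)
  then obtain r' where r': "\<alpha> = 1 + real r'"
    using assms(1) by (cases r) auto
  have "block_decay \<alpha> (2 / q + real r')"
    unfolding r' using assms by (intro block_decay_shift block_decay_1) auto
  moreover have "(2 / q + real r') * q > 1"
    using assms by (simp add: distrib_right add_pos_nonneg add_strict_increasing)
  ultimately show ?thesis by blast
next
  case False
  define r where "r = nat \<lfloor>\<alpha>\<rfloor>"
  have r: "real r = of_int \<lfloor>\<alpha>\<rfloor>"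
    using assms(1) by (simp add: r_def)
  have "\<alpha> \<noteq> real r" using False by auto
  then have b: "0 < \<alpha> - real r" "\<alpha> - real r < 1"
    unfolding r by linarith+
  have "block_decay (\<alpha> - real r + real r) (\<alpha> - real r + 1 + real r)"
    using b by (intro block_decay_shift block_decay_less_1) auto
  then show ?thesis
    using assms False by (intro exI[of _ "\<alpha> + 1"]) (auto simp: add_ac)
qed

text \<open>
  For n = 2 the quotient is 1 + X, so its powers are the binomial series. Thus the summability
  of the binomial coefficients is a special case of \<open>quot_pow_powr_sum\<close>. The proof
  checks the differential equation that characterizes the binomial series.
\<close>
lemma quot_pow_2: "quot_pow 2 a = fps_binomial a"
proof -
  have r: "ramp 2 = fps_X"
    by (simp add: ramp_def numeral_2_eq_2)
  have "fps_nth (quot_pow 2 1) k = fps_nth (1 + fps_X) k" for k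
    using quot_pow_1_nth[of 2 k] by auto
  then have one: "quot_pow 2 1 = 1 + fps_X"
    by (intro fps_ext)
  have add: "quot_pow 2 (a - 1 + 1) = quot_pow 2 (a - 1) * quot_pow 2 1"
    using one_minus_pow_add[of 2 "a - 1" 1] one_minus_pow_add[of 1 "- (a - 1)" "- 1"]
    by (simp add: quot_pow_def mult_ac)
  have "fps_X * fps_deriv (quot_pow 2 a) = fps_X * (fps_const a * quot_pow 2 (a - 1))"
    using quot_pow_deriv_Suc[of 2 "a - 1"] by (simp add: r mult_ac)
  then have "fps_deriv (quot_pow 2 a) = fps_const a * quot_pow 2 (a - 1)"
    by (simp only: mult_cancel_left) simp
  moreover have "fps_const a * quot_pow 2 a / (1 + fps_X) = fps_const a * quot_pow 2 (a - 1)"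
  proof -
    have eq: "fps_const a * quot_pow 2 a = (fps_const a * quot_pow 2 (a - 1)) * (1 + fps_X)"
      using add by (simp add: one mult.assoc)
    have "fps_nth (1 + fps_X :: real fps) 0 \<noteq> fps_nth 0 0" by simp
    then have nz: "(1 + fps_X :: real fps) \<noteq> 0" by metis
    show ?thesis
      unfolding eq by (rule nonzero_mult_div_cancel_right[OF nz])
  qed
  moreover have "fps_nth (quot_pow 2 a) 0 = 1"
    by (simp add: quot_pow_nth_0)
  ultimately show ?thesis
    using fps_binomial_ODE_unique'[of "quot_pow 2 a" a] by simp
qed

text \<open>
  The estimate on which the growth rate rests: the translations that turn a difference with step
  h into one with step nh have total weight at most of order n^((\<alpha>-1)q+1) in l^q. Its
  q-th root is n^(\<alpha> + (1/q - 1)).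
\<close>
lemma quot_pow_powr_sum:
  assumes "\<alpha> > 0" "0 < q" "q \<le> 1" "\<alpha> \<in> \<nat> \<or> (\<alpha> + 1) * q > 1"
  shows "\<exists>K\<ge>0. \<forall>n\<ge>1. summable (\<lambda>k. \<bar>fps_nth (quot_pow n \<alpha>) k\<bar> powr q)
            \<and> (\<Sum>k. \<bar>fps_nth (quot_pow n \<alpha>) k\<bar> powr q) \<le> K * real n powr ((\<alpha> - 1) * q + 1)"
proof -
  obtain s where s: "s * q > 1" "block_decay \<alpha> s"
    using block_decay_exists[of \<alpha> q] assms by blast
  obtain K0 where "\<forall>n\<ge>1. \<forall>j. (\<Sum>m<n. \<bar>fps_nth (quot_pow n \<alpha>) (j*n+m)\<bar> powr q)
       \<le> K0 * (real j + 1) powr (- (s * q)) * real n powr ((\<alpha> - 1) * q + 1)"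
    using s(2) assms unfolding block_decay_def by blast
  then have K0: "(\<Sum>m<n. \<bar>fps_nth (quot_pow n \<alpha>) (j*n+m)\<bar> powr q)
       \<le> max K0 0 * (real j + 1) powr (- (s * q)) * real n powr ((\<alpha> - 1) * q + 1)" if "n \<ge> 1" for n j
  proof -
    have "K0 * ((real j + 1) powr (- (s * q)) * real n powr ((\<alpha> - 1) * q + 1))
        \<le> max K0 0 * ((real j + 1) powr (- (s * q)) * real n powr ((\<alpha> - 1) * q + 1))"
      by (intro mult_right_mono) auto
    then show ?thesis
      using that \<open>\<forall>n\<ge>1. _\<close> unfolding mult.assoc by (meson order_trans)
  qed
  define S where "S = (\<Sum>j. (real j + 1) powr (- (s * q)))"
  have S: "(\<Sum>j<J. (real j + 1) powr (- (s * q))) \<le> S" for J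
    unfolding S_def using summable_shift_powr[OF s(1)] by (intro sum_le_suminf) auto
  have S0: "S \<ge> 0" using S[of 0] by simp
  show ?thesis
  proof (intro exI[of _ "max K0 0 * S"] conjI allI impI)
    show "max K0 0 * S \<ge> 0" using S0 by simp
    fix n :: nat assume n: "n \<ge> 1"
    define u where "u = (\<lambda>k. \<bar>fps_nth (quot_pow n \<alpha>) k\<bar> powr q)"
    have bd: "(\<Sum>k<N. u k) \<le> max K0 0 * S * real n powr ((\<alpha> - 1) * q + 1)" for N
    proof -
      have "(\<Sum>k<N. u k) \<le> (\<Sum>k<N * n. u k)"
      proof (rule sum_mono2)
        have "N * 1 \<le> N * n"
          using n by (intro mult_le_mono2)
        then show "{..<N} \<subseteq> {..<N * n}" by auto
      qed (auto simp: u_def)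
      also have "\<dots> = (\<Sum>j<N. \<Sum>m<n. u (j * n + m))"
      proof -
        have "sum u {j * n..<j * n + n} = (\<Sum>m<n. u (j * n + m))" for j
          by (rule sum.reindex_bij_witness[of _ "\<lambda>m. j * n + m" "\<lambda>k. k - j * n"]) auto
        then show ?thesis
          by (simp only: sum.nat_group[symmetric])
      qed
      also have "\<dots> \<le> (\<Sum>j<N. max K0 0 * (real j + 1) powr (- (s * q)) * real n powr ((\<alpha> - 1) * q + 1))"
        unfolding u_def by (intro sum_mono K0 n)
      also have "\<dots> = max K0 0 * real n powr ((\<alpha> - 1) * q + 1) * (\<Sum>j<N. (real j + 1) powr (- (s * q)))"
        by (simp add: sum_distrib_left mult_ac)
      also have "\<dots> \<le> max K0 0 * real n powr ((\<alpha> - 1) * q + 1) * S"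
        by (intro mult_left_mono S) auto
      finally show ?thesis by (simp add: mult_ac)
    qed
    have sm: "summable u"
      by (rule summableI_nonneg_bounded[OF _ bd]) (simp add: u_def)
    then show "summable (\<lambda>k. \<bar>fps_nth (quot_pow n \<alpha>) k\<bar> powr q)" by (simp add: u_def)
    show "(\<Sum>k. \<bar>fps_nth (quot_pow n \<alpha>) k\<bar> powr q) \<le> max K0 0 * S * real n powr ((\<alpha> - 1) * q + 1)"
      using suminf_le_const[OF sm bd] by (simp add: u_def)
  qed
qed

section \<open>Powers of weighted series\<close>

lemma powr_add_le:
  fixes x y p :: real
  assumes "0 \<le> x" "0 \<le> y" "0 < p" "p \<le> 1"
  shows "(x + y) powr p \<le> x powr p + y powr p"
proof -
  have *: "u * (x + y) powr (p - 1) \<le> u powr p" if "0 \<le> u" "u \<le> x + y" for u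
  proof (cases "u = 0")
    case False
    with that have "u * (x + y) powr (p - 1) \<le> u * u powr (p - 1)"
      using assms by (intro mult_left_mono powr_mono2') auto
    also have "\<dots> = u powr p"
      using False that powr_add[of u 1 "p - 1"] by simp
    finally show ?thesis .
  qed (use assms in simp)
  have "(x + y) powr p = x * (x + y) powr (p - 1) + y * (x + y) powr (p - 1)"
    using assms powr_add[of "x + y" 1 "p - 1"] by (cases "x + y = 0") (auto simp flip: distrib_right)
  also have "\<dots> \<le> x powr p + y powr p"
    using assms by (intro add_mono *) auto
  finally show ?thesis .
qed

lemma powr_sum_le:
  fixes a :: "'b \<Rightarrow> real" and p :: real
  assumes "finite I" "\<And>i. i \<in> I \<Longrightarrow> 0 \<le> a i" "0 < p" "p \<le> 1"
  shows "(\<Sum>i\<in>I. a i) powr p \<le> (\<Sum>i\<in>I. a i powr p)"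
  using assms(1,2)
proof (induction I rule: finite_induct)
  case (insert i I)
  have "(a i + (\<Sum>i\<in>I. a i)) powr p \<le> a i powr p + (\<Sum>i\<in>I. a i) powr p"
    using insert.prems assms by (intro powr_add_le sum_nonneg) auto
  with insert show ?case by (simp add: insert.IH order_trans)
qed simp

lemma powr_suminf_le:
  fixes a :: "nat \<Rightarrow> real" and p :: real
  assumes "\<And>i. 0 \<le> a i" "0 < p" "p \<le> 1" "summable (\<lambda>i. a i powr p)"
  shows "summable a" "(\<Sum>i. a i) powr p \<le> (\<Sum>i. a i powr p)"
proof -
  define S where "S = (\<Sum>i. a i powr p)"
  have bd: "(\<Sum>i<N. a i) \<le> S powr (1 / p)" for N
  proof -
    have "(\<Sum>i<N. a i) powr p \<le> (\<Sum>i<N. a i powr p)"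
      using assms by (intro powr_sum_le) auto
    also have "\<dots> \<le> S"
      unfolding S_def using assms by (intro sum_le_suminf) auto
    finally have "((\<Sum>i<N. a i) powr p) powr (1 / p) \<le> S powr (1 / p)"
      using assms by (intro powr_mono2) auto
    then show ?thesis
      using assms by (simp add: powr_powr sum_nonneg)
  qed
  show sm: "summable a"
    by (rule summableI_nonneg_bounded[OF assms(1) bd])
  have "(\<Sum>i. a i) \<le> S powr (1 / p)"
    by (rule suminf_le_const[OF sm bd])
  then have "(\<Sum>i. a i) powr p \<le> (S powr (1 / p)) powr p"
    using assms sm by (intro powr_mono2 suminf_nonneg) auto
  moreover have "S \<ge> 0"
    unfolding S_def using assms by (intro suminf_nonneg) auto
  ultimately show "(\<Sum>i. a i) powr p \<le> (\<Sum>i. a i powr p)"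
    using assms by (simp add: powr_powr S_def)
qed

text \<open>
  The graph of a \<mapsto> a^p lies above its tangent at t. After scaling to t = 1 this is
  Bernoulli's inequality for the exponent 1/p.
\<close>
lemma powr_tangent_le:
  fixes a t p :: real
  assumes "1 \<le> p" "0 < t" "0 \<le> a"
  shows "t powr p + p * t powr (p - 1) * (a - t) \<le> a powr p"
proof -
  define x where "x = a / t"
  have x: "x \<ge> 0" and a: "a = t * x" using assms by (auto simp: x_def)
  have "1 + p * (x - 1) \<le> x powr p"
  proof (cases "-1 \<le> p * (x - 1)")
    case True
    have "(1 + p * (x - 1)) powr (1 / p) \<le> 1 + (1 / p) * (p * (x - 1))"
      using assms True by (intro bernoulli_powr) auto
    also have "\<dots> = x" using assms by simp
    finally have "((1 + p * (x - 1)) powr (1 / p)) powr p \<le> x powr p"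
      using assms by (intro powr_mono2) auto
    then show ?thesis using assms True by (simp add: powr_powr)
  qed (smt (verit) powr_ge_zero)
  then have "t powr p * (1 + p * (x - 1)) \<le> t powr p * x powr p"
    by (intro mult_left_mono) auto
  moreover have "t powr p = t powr (p - 1) * t"
    using assms powr_add[of t "p - 1" 1] by simp
  ultimately show ?thesis
    using assms x by (simp add: a powr_mult algebra_simps)
qed

text \<open>
  Jensen's inequality for an infinite series: sum the tangent inequality at the weighted mean
  t of the a_i, where the linear term cancels.
\<close>
lemma weighted_powr_mean:
  fixes e a :: "nat \<Rightarrow> real" and p :: real
  assumes p: "1 \<le> p" and e: "\<And>i. 0 \<le> e i" "summable e" and a: "\<And>i. 0 \<le> a i"
    and sm: "summable (\<lambda>i. e i * a i powr p)"
  shows "summable (\<lambda>i. e i * a i)"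
    "(\<Sum>i. e i * a i) powr p \<le> (\<Sum>i. e i) powr (p - 1) * (\<Sum>i. e i * a i powr p)"
proof -
  have le: "a i \<le> 1 + a i powr p" for i
  proof (cases "a i \<le> 1")
    case False
    then have "a i powr 1 \<le> a i powr p" using p by (intro powr_mono) auto
    with False show ?thesis by simp
  qed (smt (verit) powr_ge_zero)
  show s1: "summable (\<lambda>i. e i * a i)"
  proof (rule summable_comparison_test')
    show "summable (\<lambda>i. e i + e i * a i powr p)"
      using e sm by (intro summable_add)
    show "norm (e i * a i) \<le> e i + e i * a i powr p" for i
      using mult_left_mono[OF le e(1), of i] e a by (simp add: abs_mult algebra_simps)
  qed
  define E where "E = (\<Sum>i. e i)"
  define T where "T = (\<Sum>i. e i * a i)"
  have E0: "E \<ge> 0" unfolding E_def using e by (intro suminf_nonneg)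
  have T0: "T \<ge> 0" unfolding T_def using e a s1 by (intro suminf_nonneg) auto
  have R0: "(\<Sum>i. e i * a i powr p) \<ge> 0" using e sm by (intro suminf_nonneg) auto
  show "T powr p \<le> E powr (p - 1) * (\<Sum>i. e i * a i powr p)"
  proof (cases "T = 0")
    case True
    then show ?thesis using R0 by simp
  next
    case False
    have "E \<noteq> 0"
    proof
      assume "E = 0"
      then have "e i = 0" for i
        using suminf_eq_zero_iff[OF e(2,1)] by (simp add: E_def)
      with False show False by (simp add: T_def)
    qed
    with E0 have E: "E > 0" by simp
    define t where "t = T / E"
    have t: "t > 0" using False T0 E by (simp add: t_def)
    have "(\<Sum>i. e i * (t powr p + p * t powr (p - 1) * (a i - t))) \<le> (\<Sum>i. e i * a i powr p)"
    proof (rule suminf_le)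
      show "e i * (t powr p + p * t powr (p - 1) * (a i - t)) \<le> e i * a i powr p" for i
        using e a p t by (intro mult_left_mono powr_tangent_le)
      show "summable (\<lambda>i. e i * (t powr p + p * t powr (p - 1) * (a i - t)))"
        using summable_add[OF summable_mult2[OF e(2), of "t powr p - p * t powr (p - 1) * t"] summable_mult2[OF s1, of "p * t powr (p - 1)"]]
        by (simp add: algebra_simps)
    qed (rule sm)
    also have "(\<lambda>i. e i * (t powr p + p * t powr (p - 1) * (a i - t)))
        = (\<lambda>i. e i * (t powr p - p * t powr (p - 1) * t) + e i * a i * (p * t powr (p - 1)))"
      by (simp add: algebra_simps)
    also have "suminf \<dots> = E * (t powr p - p * t powr (p - 1) * t) + T * (p * t powr (p - 1))"
      unfolding E_def T_def using e(2) s1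
      by (subst suminf_add[symmetric]) (auto intro: summable_mult2 simp: suminf_mult2)
    also have "\<dots> = E * t powr p"
      using E by (simp add: t_def algebra_simps)
    finally have "E powr (p - 1) * (E * t powr p) \<le> E powr (p - 1) * (\<Sum>i. e i * a i powr p)"
      by (intro mult_left_mono) auto
    moreover have "E powr (p - 1) * (E * t powr p) = T powr p"
    proof -
      have "E powr (p - 1) * E = E powr p"
        using E powr_add[of E "p - 1" 1] by simp
      then show ?thesis
        using E by (simp add: t_def powr_divide flip: mult.assoc)
    qed
    ultimately show ?thesis by simp
  qed
qed

text \<open>
  A common form of the triangle inequality for all 0 < p < \<infinity>: the power of a weighted sum
  is dominated by a sum of powers with new weights, namely e_i^p for p \<le> 1 and
  (\<Sum> e)^(p-1) e_i otherwise. When the a_i are translates of one function, all terms on the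
  right have the same integral, so integration gives the norm bound for every finite p.
\<close>
lemma shift_weights_exist:
  fixes e :: "nat \<Rightarrow> real" and p :: real
  assumes p: "0 < p" and e: "\<And>i. 0 \<le> e i" "summable (\<lambda>i. e i powr (min 1 p))"
  shows "\<exists>w. (\<forall>i. 0 \<le> w i) \<and> summable w \<and> (\<Sum>i. w i) = (\<Sum>i. e i powr (min 1 p)) powr (p / min 1 p)
     \<and> (\<forall>a. (\<forall>i. 0 \<le> a i) \<longrightarrow> summable (\<lambda>i. w i * a i powr p) \<longrightarrow>
          summable (\<lambda>i. e i * a i) \<and> (\<Sum>i. e i * a i) powr p \<le> (\<Sum>i. w i * a i powr p))"
proof (cases "p \<le> 1")
  case True
  have "(\<Sum>i. e i powr p) \<ge> 0"
    using e True by (intro suminf_nonneg) (auto simp: min_def)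
  moreover have "summable (\<lambda>i. e i * a i) \<and> (\<Sum>i. e i * a i) powr p \<le> (\<Sum>i. e i powr p * a i powr p)"
    if "\<forall>i. 0 \<le> a i" "summable (\<lambda>i. e i powr p * a i powr p)" for a
    using powr_suminf_le[of "\<lambda>i. e i * a i" p] that e p True by (simp add: powr_mult)
  ultimately show ?thesis
    using e True p by (intro exI[of _ "\<lambda>i. e i powr p"]) (auto simp: min_def split: if_splits)
next
  case False
  then have m: "min 1 p = 1" by simp
  have se: "summable e" using e by (simp add: m)
  define E where "E = (\<Sum>i. e i)"
  have E0: "E \<ge> 0" unfolding E_def using e se by (intro suminf_nonneg)
  define w where "w = (\<lambda>i. E powr (p - 1) * e i)"
  have "(\<Sum>i. w i) = E powr (p - 1) * E"
    unfolding w_def E_def by (rule suminf_mult[OF se])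
  also have "\<dots> = E powr p"
    using E0 powr_add[of E "p - 1" 1] by (cases "E = 0") auto
  finally have W: "(\<Sum>i. w i) = (\<Sum>i. e i powr (min 1 p)) powr (p / min 1 p)"
    using e by (simp add: m E_def)
  have "summable (\<lambda>i. e i * a i) \<and> (\<Sum>i. e i * a i) powr p \<le> (\<Sum>i. w i * a i powr p)"
    if a: "\<forall>i. 0 \<le> a i" "summable (\<lambda>i. w i * a i powr p)" for a
  proof (cases "E = 0")
    case True
    then have "e i = 0" for i
      using suminf_eq_zero_iff[OF se e(1)] by (simp add: E_def)
    then show ?thesis by (simp add: w_def)
  next
    case nz: False
    have "summable (\<lambda>i. inverse (E powr (p - 1)) * (w i * a i powr p))"
      by (rule summable_mult[OF a(2)])
    then have s: "summable (\<lambda>i. e i * a i powr p)"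
      using nz by (simp add: w_def field_simps)
    have "(\<Sum>i. w i * a i powr p) = E powr (p - 1) * (\<Sum>i. e i * a i powr p)"
      unfolding w_def mult.assoc by (rule suminf_mult[OF s])
    then show ?thesis
      using weighted_powr_mean[of p e a] False e se a s by (simp add: E_def)
  qed
  then show ?thesis
    using W e E0 se by (intro exI[of _ w]) (auto simp: w_def intro!: summable_mult)
qed

section \<open>Series of translates in L_p\<close>

text \<open>
  The exponent q = min(1,p) for which the q-th power of the (quasi-)norm of L_p is subadditive.
\<close>
definition summability_exponent :: "ennreal \<Rightarrow> real" where
  "summability_exponent p = (if p = \<infinity> then 1 else min 1 (enn2real p))"

lemma summability_exponent_bounds:
  assumes "0 < p"
  shows "0 < summability_exponent p" "summability_exponent p \<le> 1"
  using assms by (auto simp: summability_exponent_def enn2real_positive_iff top.not_eq_extremum)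

lemma p_excess_eq:
  assumes "0 < p"
  shows "p_excess p = 1 / summability_exponent p - 1"
proof (cases "p = \<infinity>")
  case True
  then show ?thesis by (simp add: p_excess_def summability_exponent_def)
next
  case False
  with assms obtain P where P: "p = ennreal P" "P > 0"
    by (cases p) auto
  then have e: "enn2real (1 / p) = 1 / P"
    by (simp add: divide_ennreal flip: ennreal_1)
  have "summability_exponent p = min 1 P"
    using P by (simp add: summability_exponent_def)
  then show ?thesis
    unfolding p_excess_def e using P by (auto simp: min_def max_def field_simps)
qed

lemma translation_measurable: "(\<lambda>x. x + y) \<in> lebesgue \<rightarrow>\<^sub>M (lebesgue :: 'a::euclidean_space measure)"
  using lebesgue_affine_measurable[of "\<lambda>_. 1" y]
  by (simp add: euclidean_representation add.commute)

lemma translation_distr: "distr lebesgue lebesgue (\<lambda>x. x + y) = (lebesgue :: 'a::euclidean_space measure)"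
  using lebesgue_affine_euclidean[of "\<lambda>_. 1" y]
  by (simp add: euclidean_representation add.commute density_1)

lemma nn_integral_translation:
  fixes F :: "'a::euclidean_space \<Rightarrow> ennreal"
  assumes "F \<in> borel_measurable lebesgue"
  shows "(\<integral>\<^sup>+ x. F (x + y) \<partial>lebesgue) = (\<integral>\<^sup>+ x. F x \<partial>lebesgue)"
  using nn_integral_distr[OF translation_measurable[of y], of F] assms
  by (simp add: translation_distr)

lemma AE_translation:
  fixes P :: "'a::euclidean_space \<Rightarrow> bool"
  assumes "AE x in lebesgue. P x"
  shows "AE x in lebesgue. P (x + y)"
proof (rule AE_distrD[OF translation_measurable])
  show "AE x in distr lebesgue lebesgue (\<lambda>x. x + y). P x"
    unfolding translation_distr by (rule assms)
qed

lemma ennreal_powr_mono: "0 \<le> a \<Longrightarrow> x \<le> y \<Longrightarrow> ennreal_powr x a \<le> ennreal_powr y a"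
  by (auto simp: ennreal_powr_def top_unique intro!: ennreal_leI powr_mono2 enn2real_mono)
     (simp add: top.not_eq_extremum)

lemma ennreal_powr_mult:
  assumes "0 \<le> W" "x \<noteq> \<infinity>"
  shows "ennreal_powr (ennreal W * x) a = ennreal (W powr a) * ennreal_powr x a"
proof -
  obtain r where "x = ennreal r" "r \<ge> 0" using assms(2) by (cases x) auto
  then show ?thesis
    using assms by (simp add: ennreal_powr_def powr_mult flip: ennreal_mult')
qed

text \<open>
  For finite p integrate the pointwise inequality of \<open>shift_weights_exist\<close>. Since
  the integral of the dominating series is finite, the series itself is finite almost everywhere,
  which gives the absolute convergence at the same time. For p = \<infinity> the bound holds outside
  the union of countably many translated null sets.
\<close>
lemma Lp_shift_sum:
  fixes f :: "'a::euclidean_space \<Rightarrow> complex" and e :: "nat \<Rightarrow> real" and y :: "nat \<Rightarrow> 'a"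
  assumes p: "0 < p" and f: "f \<in> Lp_space p"
    and e: "summable (\<lambda>s. \<bar>e s\<bar> powr summability_exponent p)"
  shows "AE x in lebesgue. summable (\<lambda>s. \<bar>e s\<bar> * norm (f (x + y s)))"
    and "(\<lambda>x. \<Sum>s. e s *\<^sub>R f (x + y s)) \<in> Lp_space p"
    and "Lp_norm p (\<lambda>x. \<Sum>s. e s *\<^sub>R f (x + y s))
           \<le> ennreal ((\<Sum>s. \<bar>e s\<bar> powr summability_exponent p) powr (1 / summability_exponent p)) * Lp_norm p f"
proof -
  define g where "g = (\<lambda>x. \<Sum>s. e s *\<^sub>R f (x + y s))"
  define S where "S = (\<Sum>s. \<bar>e s\<bar> powr summability_exponent p)"
  let ?C = "S powr (1 / summability_exponent p)"
  have fm [measurable]: "f \<in> borel_measurable lebesgue" and fin: "Lp_norm p f < \<infinity>"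
    using f by (auto simp: Lp_space_def)
  have ft [measurable]: "(\<lambda>x. f (x + z)) \<in> borel_measurable lebesgue" for z
    using measurable_compose[OF translation_measurable fm] by simp
  have gm [measurable]: "g \<in> borel_measurable lebesgue"
    unfolding g_def by measurable
  have S0: "S \<ge> 0" unfolding S_def using e by (intro suminf_nonneg) auto
  have norm_g: "norm (g x) \<le> (\<Sum>s. \<bar>e s\<bar> * norm (f (x + y s)))"
    if "summable (\<lambda>s. \<bar>e s\<bar> * norm (f (x + y s)))" for x
    unfolding g_def using summable_norm[of "\<lambda>s. e s *\<^sub>R f (x + y s)"] that by simp
  have "(AE x in lebesgue. summable (\<lambda>s. \<bar>e s\<bar> * norm (f (x + y s)))) \<and>
        Lp_norm p g \<le> ennreal ?C * Lp_norm p f"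
  proof (cases "p = \<infinity>")
    case True
    define M where "M = enn2real (Lp_norm p f)"
    have M: "Lp_norm p f = ennreal M" "M \<ge> 0"
      using fin by (auto simp: M_def top.not_eq_extremum)
    have q: "summability_exponent p = 1" using True by (simp add: summability_exponent_def)
    have se: "summable (\<lambda>s. \<bar>e s\<bar>)" and S: "S = (\<Sum>s. \<bar>e s\<bar>)"
      using e by (simp_all add: q S_def)
    have "AE x in lebesgue. ennreal (norm (f x)) \<le> ennreal M"
      using esssup_AE[of "\<lambda>x. ennreal (norm (f x))" lebesgue] M(1) True by (simp add: Lp_norm_def)
    then have "AE x in lebesgue. norm (f x) \<le> M"
      using M(2) by simp
    then have "AE x in lebesgue. \<forall>s. norm (f (x + y s)) \<le> M"
      unfolding AE_all_countable using AE_translation[of "\<lambda>x. norm (f x) \<le> M"] by blast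
    then have ae: "AE x in lebesgue. summable (\<lambda>s. \<bar>e s\<bar> * norm (f (x + y s))) \<and> norm (g x) \<le> S * M"
    proof eventually_elim
      case (elim x)
      have le: "\<bar>e s\<bar> * norm (f (x + y s)) \<le> \<bar>e s\<bar> * M" for s
        using elim by (intro mult_left_mono) auto
      have sm: "summable (\<lambda>s. \<bar>e s\<bar> * norm (f (x + y s)))"
        by (rule summable_comparison_test'[OF summable_mult2[OF se, of M], of 0]) (use le in auto)
      have "(\<Sum>s. \<bar>e s\<bar> * norm (f (x + y s))) \<le> (\<Sum>s. \<bar>e s\<bar> * M)"
        by (rule suminf_le[OF le sm summable_mult2[OF se]])
      also have "\<dots> = S * M"
        unfolding S by (rule suminf_mult2[OF se, symmetric])
      finally show ?case using sm norm_g[OF sm] by auto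
    qed
    have "AE x in lebesgue. ennreal (norm (g x)) \<le> ennreal (S * M)"
      using ae by eventually_elim (simp add: ennreal_leI)
    then have ess: "esssup lebesgue (\<lambda>x. ennreal (norm (g x))) \<le> ennreal (S * M)"
      by (intro esssup_I) auto
    have "Lp_norm p g \<le> ennreal ?C * Lp_norm p f"
    proof -
      have "?C = S" using S0 by (simp add: q)
      moreover have "Lp_norm p g = esssup lebesgue (\<lambda>x. ennreal (norm (g x)))"
        using True by (simp add: Lp_norm_def)
      ultimately show ?thesis
        using ess S0 M by (simp only: ennreal_mult)
    qed
    with ae show ?thesis by (auto elim: eventually_mono)
  next
    case False
    define P where "P = enn2real p"
    have P: "P > 0" using p False by (auto simp: P_def enn2real_positive_iff top.not_eq_extremum)
    have q: "summability_exponent p = min 1 P" using False by (simp add: summability_exponent_def P_def)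
    define I where "I = (\<integral>\<^sup>+ x. ennreal (norm (f x) powr P) \<partial>lebesgue)"
    have nf: "Lp_norm p f = ennreal_powr I (1 / P)"
      using False by (simp add: Lp_norm_def I_def P_def)
    have I: "I \<noteq> \<infinity>" using fin unfolding nf by (auto simp: ennreal_powr_def)
    obtain w where w: "\<And>i. 0 \<le> w i" "summable w" "(\<Sum>i. w i) = S powr (P / min 1 P)"
      "\<And>a. (\<And>i. 0 \<le> a i) \<Longrightarrow> summable (\<lambda>i. w i * a i powr P) \<Longrightarrow>
          summable (\<lambda>i. \<bar>e i\<bar> * a i) \<and> (\<Sum>i. \<bar>e i\<bar> * a i) powr P \<le> (\<Sum>i. w i * a i powr P)"
      using shift_weights_exist[of P "\<lambda>i. \<bar>e i\<bar>"] e P unfolding q S_def by auto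
    let ?G = "\<lambda>x. \<Sum>s. ennreal (w s * norm (f (x + y s)) powr P)"
    have "(\<integral>\<^sup>+ x. ?G x \<partial>lebesgue) = (\<Sum>s. \<integral>\<^sup>+ x. ennreal (w s * norm (f (x + y s)) powr P) \<partial>lebesgue)"
      by (rule nn_integral_suminf) measurable
    also have "\<dots> = (\<Sum>s. ennreal (w s) * I)"
    proof (rule suminf_cong)
      fix s
      have "(\<integral>\<^sup>+ x. ennreal (w s * norm (f (x + y s)) powr P) \<partial>lebesgue)
          = ennreal (w s) * (\<integral>\<^sup>+ x. ennreal (norm (f (x + y s)) powr P) \<partial>lebesgue)"
        using w(1) by (subst nn_integral_cmult[symmetric]) (auto simp: ennreal_mult)
      also have "(\<integral>\<^sup>+ x. ennreal (norm (f (x + y s)) powr P) \<partial>lebesgue) = I"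
        unfolding I_def by (rule nn_integral_translation[of "\<lambda>x. ennreal (norm (f x) powr P)"]) measurable
      finally show "(\<integral>\<^sup>+ x. ennreal (w s * norm (f (x + y s)) powr P) \<partial>lebesgue) = ennreal (w s) * I" .
    qed
    also have "\<dots> = ennreal (S powr (P / min 1 P)) * I"
      using w(1-3) by (simp add: ennreal_suminf_multc suminf_ennreal2)
    finally have int: "(\<integral>\<^sup>+ x. ?G x \<partial>lebesgue) = ennreal (S powr (P / min 1 P)) * I" .
    have "AE x in lebesgue. ?G x \<noteq> \<infinity>"
      using I by (intro nn_integral_noteq_infinite) (auto simp: int ennreal_mult_eq_top_iff)
    then have ae: "AE x in lebesgue. summable (\<lambda>s. \<bar>e s\<bar> * norm (f (x + y s))) \<and> ennreal (norm (g x) powr P) \<le> ?G x"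
    proof eventually_elim
      case (elim x)
      have sw: "summable (\<lambda>s. w s * norm (f (x + y s)) powr P)"
        using elim w(1) by (intro summable_suminf_not_top) auto
      note wx = w(4)[of "\<lambda>s. norm (f (x + y s))", OF norm_ge_zero sw]
      have "norm (g x) powr P \<le> (\<Sum>s. \<bar>e s\<bar> * norm (f (x + y s))) powr P"
        using wx norm_g P by (intro powr_mono2) auto
      also have "\<dots> \<le> (\<Sum>s. w s * norm (f (x + y s)) powr P)"
        using wx by simp
      finally have "ennreal (norm (g x) powr P) \<le> ennreal (\<Sum>s. w s * norm (f (x + y s)) powr P)"
        by (rule ennreal_leI)
      also have "\<dots> = ?G x"
        using sw w(1) by (intro suminf_ennreal2[symmetric]) auto
      finally show ?case using wx by simp
    qed
    have "(\<integral>\<^sup>+ x. ennreal (norm (g x) powr P) \<partial>lebesgue) \<le> ennreal (S powr (P / min 1 P)) * I"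
      unfolding int[symmetric] using ae by (intro nn_integral_mono_AE) (auto elim: eventually_mono)
    then have "ennreal_powr (\<integral>\<^sup>+ x. ennreal (norm (g x) powr P) \<partial>lebesgue) (1 / P)
        \<le> ennreal_powr (ennreal (S powr (P / min 1 P)) * I) (1 / P)"
      using P by (intro ennreal_powr_mono) auto
    also have "\<dots> = ennreal ((S powr (P / min 1 P)) powr (1 / P)) * ennreal_powr I (1 / P)"
      using I by (intro ennreal_powr_mult) auto
    also have "(S powr (P / min 1 P)) powr (1 / P) = ?C"
      using P by (simp add: powr_powr q)
    finally have "Lp_norm p g \<le> ennreal ?C * Lp_norm p f"
      using False by (simp add: Lp_norm_def[of p g] P_def nf)
    with ae show ?thesis by (auto elim: eventually_mono)
  qed
  then show "AE x in lebesgue. summable (\<lambda>s. \<bar>e s\<bar> * norm (f (x + y s)))"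
    and norm: "Lp_norm p (\<lambda>x. \<Sum>s. e s *\<^sub>R f (x + y s))
           \<le> ennreal ((\<Sum>s. \<bar>e s\<bar> powr summability_exponent p) powr (1 / summability_exponent p)) * Lp_norm p f"
    by (simp_all add: g_def S_def)
  show "(\<lambda>x. \<Sum>s. e s *\<^sub>R f (x + y s)) \<in> Lp_space p"
    using gm norm fin unfolding Lp_space_def g_def
    by (auto intro: le_less_trans simp: ennreal_mult_less_top)
qed

lemma Lp_norm_cong_AE:
  assumes "f \<in> borel_measurable lebesgue" "g \<in> borel_measurable lebesgue"
    "AE x in lebesgue. f x = g x"
  shows "Lp_norm p f = Lp_norm p g"
proof -
  have "(\<integral>\<^sup>+ x. ennreal (norm (f x) powr enn2real p) \<partial>lebesgue)
      = (\<integral>\<^sup>+ x. ennreal (norm (g x) powr enn2real p) \<partial>lebesgue)"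
    using assms(3) by (intro nn_integral_cong_AE) (auto elim: eventually_mono)
  moreover have "esssup lebesgue (\<lambda>x. ennreal (norm (f x))) = esssup lebesgue (\<lambda>x. ennreal (norm (g x)))"
    using assms by (intro esssup_AE_cong) (auto elim: eventually_mono)
  ultimately show ?thesis by (simp add: Lp_norm_def)
qed

text \<open>
  Absolute convergence allows the double series over (k,\<nu>) to be summed along the
  diagonals k + \<nu> = s.
\<close>
lemma suminf_convolution:
  fixes c b :: "nat \<Rightarrow> real" and g :: "nat \<Rightarrow> 'b::banach"
  assumes "summable (\<lambda>s. (\<Sum>i\<le>s. \<bar>c i\<bar> * \<bar>b (s - i)\<bar>) * norm (g s))"
  shows "(\<Sum>k. c k *\<^sub>R (\<Sum>\<nu>. b \<nu> *\<^sub>R g (k + \<nu>))) = (\<Sum>s. (\<Sum>i\<le>s. c i * b (s - i)) *\<^sub>R g s)"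
proof -
  define F where "F = (\<lambda>(k, \<nu>). (c k * b \<nu>) *\<^sub>R g (k + \<nu>))"
  define h where "h = (\<lambda>(s::nat, i::nat). (i, s - i))"
  have bij: "bij_betw h (Sigma UNIV (\<lambda>s. {..s})) (UNIV \<times> UNIV)"
    by (rule bij_betwI[of _ _ _ "\<lambda>(k, \<nu>). (k + \<nu>, k)"]) (auto simp: h_def)
  have Fh: "F (h (s, i)) = (c i * b (s - i)) *\<^sub>R g s" if "i \<le> s" for s i
    using that by (simp add: F_def h_def)
  have conv: "infsum u UNIV = suminf u" if "u summable_on UNIV" for u :: "nat \<Rightarrow> 'b"
    using has_sum_imp_sums[OF has_sum_infsum[OF that]] by (simp add: sums_iff)
  have "(\<lambda>x. norm (F (h x))) summable_on Sigma UNIV (\<lambda>s. {..s})"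
    unfolding Infinite_Sum.abs_summable_on_Sigma_iff
  proof (intro conjI ballI)
    have "(\<Sum>\<^sub>\<infinity>i\<in>{..s}. norm (F (h (s, i)))) = (\<Sum>i\<le>s. \<bar>c i\<bar> * \<bar>b (s - i)\<bar>) * norm (g s)" for s
      by (simp add: Fh abs_mult sum_distrib_right)
    moreover have "\<bar>\<Sum>i\<le>s. \<bar>c i\<bar> * \<bar>b (s - i)\<bar>\<bar> = (\<Sum>i\<le>s. \<bar>c i\<bar> * \<bar>b (s - i)\<bar>)" for s
      by (intro abs_of_nonneg sum_nonneg) auto
    ultimately show "(\<lambda>s. norm (\<Sum>\<^sub>\<infinity>i\<in>{..s}. norm (F (h (s, i))))) summable_on UNIV"
      using assms
      by (intro iffD2[OF summable_on_UNIV_nonneg_real_iff[OF norm_ge_zero]]) (simp add: abs_mult)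
  qed simp
  then have sh: "(\<lambda>x. F (h x)) summable_on Sigma UNIV (\<lambda>s. {..s})"
    by (rule abs_summable_summable)
  then have sF: "F summable_on UNIV \<times> UNIV"
    using summable_on_reindex_bij_betw[OF bij, of F] by simp
  have inner: "(\<lambda>\<nu>. b \<nu> *\<^sub>R g (k + \<nu>)) summable_on UNIV" if "c k \<noteq> 0" for k
  proof -
    have "F summable_on range (Pair k)"
      by (rule summable_on_subset_banach[OF sF]) auto
    then have "(\<lambda>\<nu>. F (k, \<nu>)) summable_on UNIV"
      using summable_on_reindex[of "Pair k" UNIV F] by (simp add: inj_on_def o_def)
    then have "(\<lambda>\<nu>. inverse (c k) *\<^sub>R F (k, \<nu>)) summable_on UNIV"
      by (rule summable_on_scaleR_right)
    then show ?thesis using that by (simp add: F_def mult.assoc[symmetric])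
  qed
  have "(\<Sum>\<^sub>\<infinity>\<nu>. F (k, \<nu>)) = c k *\<^sub>R (\<Sum>\<nu>. b \<nu> *\<^sub>R g (k + \<nu>))" for k
  proof (cases "c k = 0")
    case False
    have "(\<Sum>\<^sub>\<infinity>\<nu>. F (k, \<nu>)) = (\<Sum>\<^sub>\<infinity>\<nu>. c k *\<^sub>R (b \<nu> *\<^sub>R g (k + \<nu>)))"
      by (simp add: F_def)
    also have "\<dots> = c k *\<^sub>R (\<Sum>\<^sub>\<infinity>\<nu>. b \<nu> *\<^sub>R g (k + \<nu>))"
      by (rule infsum_scaleR_right)
    finally show ?thesis using conv[OF inner[OF False]] by simp
  qed (simp add: F_def)
  moreover have "(\<lambda>k. \<Sum>\<^sub>\<infinity>\<nu>. F (k, \<nu>)) summable_on UNIV"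
    using summable_on_Sigma_banach[of "\<lambda>k \<nu>. F (k, \<nu>)" UNIV "\<lambda>_. UNIV"] sF by simp
  ultimately have "(\<Sum>k. c k *\<^sub>R (\<Sum>\<nu>. b \<nu> *\<^sub>R g (k + \<nu>))) = infsum F (UNIV \<times> UNIV)"
    using conv infsum_Sigma_banach[OF sF] by simp
  also have "\<dots> = infsum (\<lambda>x. F (h x)) (Sigma UNIV (\<lambda>s. {..s}))"
    by (rule infsum_reindex_bij_betw[OF bij, symmetric])
  also have "\<dots> = (\<Sum>\<^sub>\<infinity>s. \<Sum>\<^sub>\<infinity>i\<in>{..s}. F (h (s, i)))"
    by (rule infsum_Sigma_banach[OF sh, symmetric])
  also have "\<dots> = (\<Sum>s. \<Sum>\<^sub>\<infinity>i\<in>{..s}. F (h (s, i)))"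
    using summable_on_Sigma_banach[of "\<lambda>s i. F (h (s, i))" UNIV "\<lambda>s. {..s}"] sh
    by (intro conv) (simp add: case_prod_unfold)
  also have "\<dots> = (\<Sum>s. (\<Sum>i\<le>s. c i * b (s - i)) *\<^sub>R g s)"
    by (simp add: Fh scaleR_sum_left)
  finally show ?thesis .
qed

lemma convolution_powr_summable:
  fixes c b :: "nat \<Rightarrow> real"
  assumes "0 < q" "q \<le> 1" "summable (\<lambda>k. \<bar>c k\<bar> powr q)" "summable (\<lambda>k. \<bar>b k\<bar> powr q)"
  shows "summable (\<lambda>s. (\<Sum>i\<le>s. \<bar>c i\<bar> * \<bar>b (s - i)\<bar>) powr q)"
proof (rule summable_comparison_test')
  show "summable (\<lambda>s. \<Sum>i\<le>s. \<bar>c i\<bar> powr q * \<bar>b (s - i)\<bar> powr q)"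
    using assms by (intro summable_Cauchy_product) auto
  show "norm ((\<Sum>i\<le>s. \<bar>c i\<bar> * \<bar>b (s - i)\<bar>) powr q) \<le> (\<Sum>i\<le>s. \<bar>c i\<bar> powr q * \<bar>b (s - i)\<bar> powr q)" for s
    using powr_sum_le[of "{..s}" "\<lambda>i. \<bar>c i\<bar> * \<bar>b (s - i)\<bar>" q] assms by (simp add: powr_mult)
qed

section \<open>Dilating the step of a fractional difference\<close>

lemma summability_exponent_admissible:
  assumes "0 < p" "\<alpha> \<in> (\<nat> - {0}) \<union> {p_excess p <..}"
  shows "\<alpha> > 0" "\<alpha> \<in> \<nat> \<or> (\<alpha> + 1) * summability_exponent p > 1"
proof -
  note q = summability_exponent_bounds[OF assms(1)]
  have ex: "p_excess p \<ge> 0" by (simp add: p_excess_def)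
  show "\<alpha> > 0"
    using assms(2) ex by (auto simp: Nats_def)
  show "\<alpha> \<in> \<nat> \<or> (\<alpha> + 1) * summability_exponent p > 1"
    using assms(2) q unfolding p_excess_eq[OF assms(1)] by (auto simp: field_simps)
qed

lemma binomial_powr_summable:
  fixes \<alpha> q :: real
  assumes "\<alpha> > 0" "0 < q" "q \<le> 1" "\<alpha> \<in> \<nat> \<or> (\<alpha> + 1) * q > 1"
  shows "summable (\<lambda>\<nu>. \<bar>(- 1) ^ \<nu> * (\<alpha> gchoose \<nu>)\<bar> powr q)"
proof -
  obtain K where "\<forall>n\<ge>1. summable (\<lambda>k. \<bar>fps_nth (quot_pow n \<alpha>) k\<bar> powr q)"
    using quot_pow_powr_sum[OF assms] by blast
  then have "summable (\<lambda>k. \<bar>fps_nth (quot_pow 2 \<alpha>) k\<bar> powr q)" by simp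
  then show ?thesis by (simp add: quot_pow_2 abs_mult)
qed

lemma frac_diff_in_Lp_space:
  assumes "0 < p" "\<alpha> \<in> (\<nat> - {0}) \<union> {p_excess p <..}" "f \<in> Lp_space p"
  shows "frac_diff \<alpha> h f \<in> Lp_space p"
  unfolding frac_diff_def
  using summability_exponent_admissible[OF assms(1,2)] summability_exponent_bounds[OF assms(1)]
  by (intro Lp_shift_sum(2)[OF assms(1,3)] binomial_powr_summable)

text \<open>
  With T the translation by -h, the difference with step h is (1-T)^\<alpha> f translated by
  \<alpha> h. The identity is (1-T^n)^\<alpha> = Q(T) (1-T)^\<alpha> with Q the quotient power.
  The term \<alpha>(n-1)h is the difference between the offsets \<alpha> n h and \<alpha> h.
\<close>
lemma frac_diff_dilate:
  fixes f :: "'a::euclidean_space \<Rightarrow> complex"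
  assumes p: "0 < p" "\<alpha> \<in> (\<nat> - {0}) \<union> {p_excess p <..}" and f: "f \<in> Lp_space p" and n: "n \<ge> 1"
  shows "AE x in lebesgue. frac_diff \<alpha> (real n *\<^sub>R h) f x
    = (\<Sum>k. fps_nth (quot_pow n \<alpha>) k *\<^sub>R frac_diff \<alpha> h f (x + (\<alpha> * (real n - 1) - real k) *\<^sub>R h))"
proof -
  note q = summability_exponent_bounds[OF p(1)]
  note adm = summability_exponent_admissible[OF p]
  define c where "c = fps_nth (quot_pow n \<alpha>)"
  define b where "b = (\<lambda>\<nu>. (- 1) ^ \<nu> * (\<alpha> gchoose \<nu>))"
  define y where "y = (\<lambda>s. (\<alpha> * real n - real s) *\<^sub>R h)"
  have cs: "summable (\<lambda>k. \<bar>c k\<bar> powr summability_exponent p)"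
    using quot_pow_powr_sum[OF adm(1) q adm(2)] n unfolding c_def by blast
  have bs: "summable (\<lambda>k. \<bar>b k\<bar> powr summability_exponent p)"
    unfolding b_def by (rule binomial_powr_summable[OF adm(1) q adm(2)])
  have nn: "\<bar>\<Sum>i\<le>s. \<bar>c i\<bar> * \<bar>b (s - i)\<bar>\<bar> = (\<Sum>i\<le>s. \<bar>c i\<bar> * \<bar>b (s - i)\<bar>)" for s
    by (intro abs_of_nonneg sum_nonneg) auto
  have cb: "(\<Sum>i\<le>s. c i * b (s - i)) = fps_nth (one_minus_pow n \<alpha>) s" for s
    unfolding quot_pow_mult[of n \<alpha>, symmetric] fps_mult_nth
    by (simp add: c_def b_def one_minus_pow_nth atLeast0AtMost)
  have "AE x in lebesgue. summable (\<lambda>s. (\<Sum>i\<le>s. \<bar>c i\<bar> * \<bar>b (s - i)\<bar>) * norm (f (x + y s)))"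
    using Lp_shift_sum(1)[OF p(1) f, of "\<lambda>s. \<Sum>i\<le>s. \<bar>c i\<bar> * \<bar>b (s - i)\<bar>" y]
      convolution_powr_summable[OF q cs bs] by (simp only: nn)
  then show ?thesis
  proof eventually_elim
    case (elim x)
    have "frac_diff \<alpha> h f (x + (\<alpha> * (real n - 1) - real k) *\<^sub>R h) = (\<Sum>\<nu>. b \<nu> *\<^sub>R f (x + y (k + \<nu>)))" for k
      unfolding frac_diff_def b_def y_def by (simp add: algebra_simps)
    then have "(\<Sum>k. c k *\<^sub>R frac_diff \<alpha> h f (x + (\<alpha> * (real n - 1) - real k) *\<^sub>R h))
        = (\<Sum>k. c k *\<^sub>R (\<Sum>\<nu>. b \<nu> *\<^sub>R f (x + y (k + \<nu>))))"
      by simp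
    also have "\<dots> = (\<Sum>s. fps_nth (one_minus_pow n \<alpha>) s *\<^sub>R f (x + y s))"
      unfolding suminf_convolution[OF elim] cb ..
    also have "\<dots> = (\<Sum>\<nu>. fps_nth (one_minus_pow n \<alpha>) (n * \<nu>) *\<^sub>R f (x + y (n * \<nu>)))"
      using n by (intro suminf_mono_reindex[symmetric] strict_monoI)
         (auto simp: one_minus_pow_nth elim!: dvdE)
    also have "\<dots> = frac_diff \<alpha> (real n *\<^sub>R h) f x"
      using n by (simp add: frac_diff_def one_minus_pow_nth y_def algebra_simps)
    finally show ?case by (simp add: c_def)
  qed
qed

lemma Lp_norm_frac_diff_dilate:
  assumes p: "0 < p" "\<alpha> \<in> (\<nat> - {0}) \<union> {p_excess p <..}"
  shows "\<exists>C\<ge>0. \<forall>f \<in> (Lp_space p :: ('a::euclidean_space \<Rightarrow> complex) set). \<forall>n\<ge>1. \<forall>h.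
    Lp_norm p (frac_diff \<alpha> (real n *\<^sub>R h) f)
      \<le> ennreal (C * real n powr (\<alpha> + p_excess p)) * Lp_norm p (frac_diff \<alpha> h f)"
proof -
  define q where "q = summability_exponent p"
  note q = summability_exponent_bounds[OF p(1), folded q_def]
  note adm = summability_exponent_admissible[OF p, folded q_def]
  obtain K where K: "K \<ge> 0" "\<And>n. n \<ge> 1 \<Longrightarrow> summable (\<lambda>k. \<bar>fps_nth (quot_pow n \<alpha>) k\<bar> powr q)"
    "\<And>n. n \<ge> 1 \<Longrightarrow> (\<Sum>k. \<bar>fps_nth (quot_pow n \<alpha>) k\<bar> powr q) \<le> K * real n powr ((\<alpha> - 1) * q + 1)"
    using quot_pow_powr_sum[OF adm(1) q adm(2)] by blast
  show ?thesis
  proof (intro exI[of _ "K powr (1 / q)"] conjI ballI allI impI)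
    fix f :: "'a \<Rightarrow> complex" and n :: nat and h :: 'a
    assume f: "f \<in> Lp_space p" and n: "n \<ge> 1"
    let ?F = "frac_diff \<alpha> h f" and ?c = "fps_nth (quot_pow n \<alpha>)"
    let ?y = "\<lambda>k. (\<alpha> * (real n - 1) - real k) *\<^sub>R h"
    note S = Lp_shift_sum[OF p(1) frac_diff_in_Lp_space[OF p f], folded q_def, OF K(2)[OF n], of h ?y]
    have "Lp_norm p (frac_diff \<alpha> (real n *\<^sub>R h) f) = Lp_norm p (\<lambda>x. \<Sum>k. ?c k *\<^sub>R ?F (x + ?y k))"
      using frac_diff_dilate[OF p f n] frac_diff_in_Lp_space[OF p f] S(2)
      by (intro Lp_norm_cong_AE) (auto simp: Lp_space_def)
    also have "\<dots> \<le> ennreal ((\<Sum>k. \<bar>?c k\<bar> powr q) powr (1 / q)) * Lp_norm p ?F"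
      by (rule S(3))
    also have "\<dots> \<le> ennreal (K powr (1 / q) * real n powr (\<alpha> + p_excess p)) * Lp_norm p ?F"
    proof (intro mult_right_mono ennreal_leI)
      have "(\<Sum>k. \<bar>?c k\<bar> powr q) powr (1 / q) \<le> (K * real n powr ((\<alpha> - 1) * q + 1)) powr (1 / q)"
        using q K(2,3)[OF n] by (intro powr_mono2 suminf_nonneg) auto
      also have "\<dots> = K powr (1 / q) * real n powr (((\<alpha> - 1) * q + 1) / q)"
        using K(1) by (simp add: powr_mult powr_powr)
      also have "((\<alpha> - 1) * q + 1) / q = \<alpha> + p_excess p"
        unfolding p_excess_eq[OF p(1), folded q_def] using q by (simp add: field_simps)
      finally show "(\<Sum>k. \<bar>?c k\<bar> powr q) powr (1 / q) \<le> K powr (1 / q) * real n powr (\<alpha> + p_excess p)" .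
    qed simp
    finally show "Lp_norm p (frac_diff \<alpha> (real n *\<^sub>R h) f)
      \<le> ennreal (K powr (1 / q) * real n powr (\<alpha> + p_excess p)) * Lp_norm p ?F" .
  qed simp
qed

section \<open>Growth of the modulus of smoothness\<close>

theorem mainTheorem1:
  fixes p :: ennreal and \<alpha> :: real
  assumes "0 < p"
    and "\<alpha> \<in> (\<nat> - {0}) \<union> {p_excess p <..}"
  shows
    "(\<exists>C>0. \<forall>f \<in> (Lp_space p :: (real ^ 'n \<Rightarrow> complex) set). \<forall>lam>0. \<forall>\<delta>>0.
        modulus_smoothness \<alpha> p f (lam * \<delta>)
          \<le> ennreal (C * (1 + lam) powr (\<alpha> + real CARD('n) * p_excess p))
              * modulus_smoothness \<alpha> p f \<delta>)
     \<and>
     (\<exists>C>0. \<forall>f \<in> (Lp_space p :: (real ^ 'n \<Rightarrow> complex) set). \<forall>h>0. \<forall>\<delta>>h.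
        modulus_smoothness \<alpha> p f \<delta> / ennreal (\<delta> powr (\<alpha> + real CARD('n) * p_excess p))
          \<le> ennreal C *
             (modulus_smoothness \<alpha> p f h / ennreal (h powr (\<alpha> + real CARD('n) * p_excess p))))"
proof -
  define E where "E = \<alpha> + real CARD('n) * p_excess p"
  obtain C where C: "C \<ge> 0" "\<And>f n h. f \<in> (Lp_space p :: (real ^ 'n \<Rightarrow> complex) set) \<Longrightarrow> n \<ge> 1 \<Longrightarrow>
    Lp_norm p (frac_diff \<alpha> (real n *\<^sub>R h) f)
      \<le> ennreal (C * real n powr (\<alpha> + p_excess p)) * Lp_norm p (frac_diff \<alpha> h f)"
    using Lp_norm_frac_diff_dilate[OF assms] by blast
  have ex: "p_excess p \<ge> 0" by (simp add: p_excess_def)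
  have a0: "\<alpha> > 0" using summability_exponent_admissible[OF assms] by simp
  have "CARD('n) > 0" by simp
  then have "1 * p_excess p \<le> real CARD('n) * p_excess p"
    using ex by (intro mult_right_mono) auto
  then have E: "\<alpha> + p_excess p \<le> E" "E > 0"
    using a0 ex by (auto simp: E_def)
  \<comment> \<open>The constant \<open>C + 1\<close> is positive even if \<open>C = 0\<close>.\<close>
  have main: "modulus_smoothness \<alpha> p f (lam * \<delta>) \<le> ennreal ((C + 1) * (1 + lam) powr E) * modulus_smoothness \<alpha> p f \<delta>"
    if f: "f \<in> (Lp_space p :: (real ^ 'n \<Rightarrow> complex) set)" and lam: "lam > 0" and \<delta>: "\<delta> > 0" for f lam \<delta>
    unfolding modulus_smoothness_def[of \<alpha> p f "lam * \<delta>"]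
  proof (rule SUP_least)
    fix H :: "real ^ 'n"
    assume H: "H \<in> {h. norm h \<le> lam * \<delta>}"
    \<comment> \<open>The number of steps: each has length at most \<open>\<delta>\<close>, because \<open>lam \<le> n\<close>.\<close>
    define n where "n = nat \<lceil>lam\<rceil>"
    have n: "n \<ge> 1" "lam \<le> real n" "real n \<le> 1 + lam"
      using lam unfolding n_def by linarith+
    define h where "h = H /\<^sub>R real n"
    have Hh: "H = real n *\<^sub>R h" using n by (simp add: h_def)
    have "real n * norm h \<le> lam * \<delta>" using H by (simp add: Hh)
    also have "\<dots> \<le> real n * \<delta>" using n \<delta> by (intro mult_right_mono) auto
    finally have hd: "norm h \<le> \<delta>" using n by simp
    have "Lp_norm p (frac_diff \<alpha> H f) \<le> ennreal (C * real n powr (\<alpha> + p_excess p)) * Lp_norm p (frac_diff \<alpha> h f)"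
      unfolding Hh by (rule C(2)[OF f n(1)])
    also have "\<dots> \<le> ennreal ((C + 1) * (1 + lam) powr E) * modulus_smoothness \<alpha> p f \<delta>"
    proof (intro mult_mono ennreal_leI)
      have "real n powr (\<alpha> + p_excess p) \<le> (1 + lam) powr (\<alpha> + p_excess p)"
        using n a0 ex by (intro powr_mono2) auto
      also have "\<dots> \<le> (1 + lam) powr E"
        using lam E by (intro powr_mono) auto
      finally show "real n powr (\<alpha> + p_excess p) \<le> (1 + lam) powr E" .
      show "Lp_norm p (frac_diff \<alpha> h f) \<le> modulus_smoothness \<alpha> p f \<delta>"
        unfolding modulus_smoothness_def using hd by (intro SUP_upper) simp
    qed (use C(1) in auto)
    finally show "Lp_norm p (frac_diff \<alpha> H f) \<le> ennreal ((C + 1) * (1 + lam) powr E) * modulus_smoothness \<alpha> p f \<delta>" .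
  qed
  have second: "modulus_smoothness \<alpha> p f \<delta> / ennreal (\<delta> powr E)
      \<le> ennreal ((C + 1) * 2 powr E) * (modulus_smoothness \<alpha> p f h / ennreal (h powr E))"
    if f: "f \<in> (Lp_space p :: (real ^ 'n \<Rightarrow> complex) set)" and h: "h > 0" and \<delta>: "\<delta> > h" for f h \<delta>
  proof -
    have "1 \<le> \<delta> / h" using h \<delta> by simp
    then have "(1 + \<delta> / h) powr E \<le> (2 * (\<delta> / h)) powr E"
      using E by (intro powr_mono2) linarith+
    also have "\<dots> = 2 powr E * \<delta> powr E * (1 / h powr E)"
      by (simp add: powr_mult powr_divide)
    finally have "(1 + \<delta> / h) powr E \<le> 2 powr E * \<delta> powr E * (1 / h powr E)" .
    then have le: "(C + 1) * (1 + \<delta> / h) powr E \<le> (C + 1) * 2 powr E * (1 / h powr E) * \<delta> powr E"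
      using mult_left_mono[of "(1 + \<delta> / h) powr E" "2 powr E * \<delta> powr E * (1 / h powr E)" "C + 1"] C(1)
      by (simp add: mult_ac)
    have inv: "inverse (ennreal (h powr E)) = ennreal (1 / h powr E)"
      using h by (simp add: inverse_ennreal inverse_eq_divide)
    have "modulus_smoothness \<alpha> p f \<delta> = modulus_smoothness \<alpha> p f (\<delta> / h * h)"
      using h by simp
    also have "\<dots> \<le> ennreal ((C + 1) * (1 + \<delta> / h) powr E) * modulus_smoothness \<alpha> p f h"
      using h \<delta> by (intro main f) auto
    also have "\<dots> \<le> ennreal ((C + 1) * 2 powr E * (1 / h powr E) * \<delta> powr E) * modulus_smoothness \<alpha> p f h"
      by (intro mult_right_mono ennreal_leI le) simp
    also have "\<dots> = (ennreal ((C + 1) * 2 powr E) * (modulus_smoothness \<alpha> p f h / ennreal (h powr E))) * ennreal (\<delta> powr E)"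
    proof -
      have "ennreal ((C + 1) * 2 powr E * (1 / h powr E) * \<delta> powr E)
          = ennreal ((C + 1) * 2 powr E) * ennreal (1 / h powr E) * ennreal (\<delta> powr E)"
        using C(1) ennreal_mult[of "(C + 1) * 2 powr E * (1 / h powr E)" "\<delta> powr E"]
          ennreal_mult[of "(C + 1) * 2 powr E" "1 / h powr E"] by simp
      then show ?thesis
        by (simp only: divide_ennreal_def inv mult_ac)
    qed
    finally have "modulus_smoothness \<alpha> p f \<delta> / ennreal (\<delta> powr E)
        \<le> (ennreal ((C + 1) * 2 powr E) * (modulus_smoothness \<alpha> p f h / ennreal (h powr E))) * ennreal (\<delta> powr E) / ennreal (\<delta> powr E)"
      by (rule divide_right_mono_ennreal)
    also have "\<dots> = ennreal ((C + 1) * 2 powr E) * (modulus_smoothness \<alpha> p f h / ennreal (h powr E))"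
      using h \<delta> by (intro ennreal_mult_divide_eq) auto
    finally show ?thesis .
  qed
  show ?thesis
    unfolding E_def[symmetric]
  proof (intro conjI)
    show "\<exists>C>0. \<forall>f \<in> (Lp_space p :: (real ^ 'n \<Rightarrow> complex) set). \<forall>lam>0. \<forall>\<delta>>0.
        modulus_smoothness \<alpha> p f (lam * \<delta>) \<le> ennreal (C * (1 + lam) powr E) * modulus_smoothness \<alpha> p f \<delta>"
      using main C(1) by (intro exI[of _ "C + 1"]) auto
    show "\<exists>C>0. \<forall>f \<in> (Lp_space p :: (real ^ 'n \<Rightarrow> complex) set). \<forall>h>0. \<forall>\<delta>>h.
        modulus_smoothness \<alpha> p f \<delta> / ennreal (\<delta> powr E)
          \<le> ennreal C * (modulus_smoothness \<alpha> p f h / ennreal (h powr E))"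
      using second C(1) by (intro exI[of _ "(C + 1) * 2 powr E"]) auto
  qed
qed

end
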